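(* Let $(K,\delta)$ be a sufficiently saturated algebraically closed differential field equipped with a non-trivial derivation $\delta$, and let $E=\{x\in K\mid \delta(x)=0\}$ be its field of constants. Consider the pair $(K,E)$ as a structure in the language $\mathcal L_P=\{+,-,\cdot,0,1,P\}$ with $P(K)=E$. Let $\varphi(x,y)$ be a tame formula and let $b$ be a tuple in $K$ of length $|y|$. Then the set $\{a\in K^{|x|}\mid (K,E)\models\varphi(a,b)\}$ is Kolchin-closed in $(K,\delta)$.
   Context: A formula $\varphi(x)$ in the language $\mathcal L_P$ (with $x$ a tuple of variables) is tame if there are polynomials $q_1,\dots,q_m\in\mathbb Z[X,Z]$, homogeneous in the variables $Z=(Z_1,\dots,Z_r)$, such that $$\varphi(x)\;=\;\exists\,\zeta\in P^r\Bigl(\neg\,\zeta\doteq 0\;\wedge\;\bigwedge_{j\le m}q_j(x,\zeta)\doteq 0\Bigr),$$ where $\zeta\in P^r$ means that $\zeta$ is an $r$-tuple of elements of $P$, and $\neg\,\zeta\doteq 0$ means that $\zeta$ is not the zero tuple. (For $\varphi(x,y)$ the role of $x$ is played by the tuple $(x,y)$.) A Kolchin-closed set in a differential field $(K,\delta)$ is the zero set in $K^n$ of a system of differential polynomial equations with coefficients in $K$, i.e. polynomial equations in the variables and their iterated derivatives under $\delta$. (An algebraically closed field with a non-trivial derivation necessarily has characteristic $0$.) *)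

theory Defs
  imports
    "HOL-Computational_Algebra.Polynomial"
    "HOL-Library.Poly_Mapping"
    "HOL-Library.More_List"
begin

section \<open>Differential fields\<close>

definition derivation :: "('a::comm_ring_1 \<Rightarrow> 'a) \<Rightarrow> bool" where
  "derivation \<delta> \<longleftrightarrow>
     (\<forall>x y. \<delta> (x + y) = \<delta> x + \<delta> y) \<and> (\<forall>x y. \<delta> (x * y) = \<delta> x * y + x * \<delta> y)"

definition constants :: "('a::zero \<Rightarrow> 'a) \<Rightarrow> 'a set" where
  "constants \<delta> = {x. \<delta> x = 0}"


section \<open>First-order formulas over a set of atomic formulas\<close>

text \<open>Variables are numbered. A language is given by its type of atomic formulas and a structure
  by the truth values of the atomic formulas under assignments of the variables.\<close>

datatype 'at fm = Atom 'at | Truth | Neg "'at fm" | Conj "'at fm" "'at fm" | Ex nat "'at fm"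

primrec sat :: "('at \<Rightarrow> (nat \<Rightarrow> 'a) \<Rightarrow> bool) \<Rightarrow> (nat \<Rightarrow> 'a) \<Rightarrow> 'at fm \<Rightarrow> bool" where
  "sat I e (Atom A) = I A e"
| "sat I e Truth = True"
| "sat I e (Neg \<phi>) = (\<not> sat I e \<phi>)"
| "sat I e (Conj \<phi> \<psi>) = (sat I e \<phi> \<and> sat I e \<psi>)"
| "sat I e (Ex v \<phi>) = (\<exists>c. sat I (e(v := c)) \<phi>)"

definition conjs :: "'at fm list \<Rightarrow> 'at fm" where
  "conjs \<phi>s = foldr Conj \<phi>s Truth"

definition exs :: "nat list \<Rightarrow> 'at fm \<Rightarrow> 'at fm" where
  "exs vs \<phi> = foldr Ex vs \<phi>"

text \<open>\<open>\<kappa>\<close>-saturation: every finitely satisfiable 1-type over fewer than \<open>\<kappa>\<close> parameters is realised.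
  The type is a set of pairs \<open>(\<phi>, e)\<close>, standing for the formula \<open>\<phi>\<close> in which variable \<open>0\<close> is kept and
  every other variable \<open>i\<close> is replaced by the parameter \<open>e i \<in> A\<close>. (Assignments being total, only
  nonempty \<open>A\<close> matter; for infinite \<open>\<kappa>\<close> this is no restriction, as \<open>A\<close> can be enlarged by a point.)\<close>

definition saturated :: "'c rel \<Rightarrow> ('at \<Rightarrow> (nat \<Rightarrow> 'a) \<Rightarrow> bool) \<Rightarrow> bool" where
  "saturated \<kappa> I \<longleftrightarrow>
     (\<forall>A \<Gamma>. (card_of A, \<kappa>) \<in> ordLess \<longrightarrow>
        (\<forall>(\<phi>, e) \<in> \<Gamma>. \<forall>i. e i \<in> A) \<longrightarrow>
        (\<forall>\<Gamma>\<^sub>0 \<subseteq> \<Gamma>. finite \<Gamma>\<^sub>0 \<longrightarrow> (\<exists>c. \<forall>(\<phi>, e) \<in> \<Gamma>\<^sub>0. sat I (e(0 := c)) \<phi>)) \<longrightarrow>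
        (\<exists>c. \<forall>(\<phi>, e) \<in> \<Gamma>. sat I (e(0 := c)) \<phi>))"


section \<open>The language of differential rings\<close>

datatype dtm = DVar nat | DZero | DOne | DAdd dtm dtm | DSub dtm dtm | DMul dtm dtm | Deriv dtm

primrec dtm_val :: "('a::comm_ring_1 \<Rightarrow> 'a) \<Rightarrow> (nat \<Rightarrow> 'a) \<Rightarrow> dtm \<Rightarrow> 'a" where
  "dtm_val \<delta> e (DVar i) = e i"
| "dtm_val \<delta> e DZero = 0"
| "dtm_val \<delta> e DOne = 1"
| "dtm_val \<delta> e (DAdd s t) = dtm_val \<delta> e s + dtm_val \<delta> e t"
| "dtm_val \<delta> e (DSub s t) = dtm_val \<delta> e s - dtm_val \<delta> e t"
| "dtm_val \<delta> e (DMul s t) = dtm_val \<delta> e s * dtm_val \<delta> e t"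
| "dtm_val \<delta> e (Deriv t) = \<delta> (dtm_val \<delta> e t)"

datatype d_atom = DEq dtm dtm

primrec diff_structure ::
    "('a::comm_ring_1 \<Rightarrow> 'a) \<Rightarrow> d_atom \<Rightarrow> (nat \<Rightarrow> 'a) \<Rightarrow> bool" where
  "diff_structure \<delta> (DEq s t) e \<longleftrightarrow> dtm_val \<delta> e s = dtm_val \<delta> e t"


section \<open>The language \<open>{+, -, \<cdot>, 0, 1, P}\<close>\<close>

datatype tm = Var nat | Zero | One | Add tm tm | Sub tm tm | Mul tm tm

primrec tm_val :: "(nat \<Rightarrow> 'a::comm_ring_1) \<Rightarrow> tm \<Rightarrow> 'a" where
  "tm_val e (Var i) = e i"
| "tm_val e Zero = 0"
| "tm_val e One = 1"
| "tm_val e (Add s t) = tm_val e s + tm_val e t"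
| "tm_val e (Sub s t) = tm_val e s - tm_val e t"
| "tm_val e (Mul s t) = tm_val e s * tm_val e t"

primrec tm_vars :: "tm \<Rightarrow> nat set" where
  "tm_vars (Var i) = {i}"
| "tm_vars Zero = {}"
| "tm_vars One = {}"
| "tm_vars (Add s t) = tm_vars s \<union> tm_vars t"
| "tm_vars (Sub s t) = tm_vars s \<union> tm_vars t"
| "tm_vars (Mul s t) = tm_vars s \<union> tm_vars t"

datatype p_atom = Eq tm tm | InP tm

primrec pair_structure ::
    "('a::comm_ring_1) set \<Rightarrow> p_atom \<Rightarrow> (nat \<Rightarrow> 'a) \<Rightarrow> bool" where
  "pair_structure E (Eq s t) e \<longleftrightarrow> tm_val e s = tm_val e t"
| "pair_structure E (InP t) e \<longleftrightarrow> tm_val e t \<in> E"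

text \<open>\<open>(K, E) \<Turnstile> \<phi>(a)\<close>: variable \<open>i\<close> takes the value \<open>a ! i\<close> for \<open>i < length a\<close>
  (the default \<open>0\<close> is only for variables that do not occur freely).\<close>

definition pair_models :: "('a::comm_ring_1) set \<Rightarrow> p_atom fm \<Rightarrow> 'a list \<Rightarrow> bool" where
  "pair_models E \<phi> a \<longleftrightarrow> sat (pair_structure E) (nth_default 0 a) \<phi>"


section \<open>Tame formulas\<close>

text \<open>Multivariate polynomials: a monomial \<open>\<nu> \<Rightarrow>\<^sub>0 nat\<close> maps variables to exponents, a polynomial
  \<open>(\<nu> \<Rightarrow>\<^sub>0 nat) \<Rightarrow>\<^sub>0 'a\<close> maps monomials to coefficients, with the convolution product.\<close>

primrec tm_poly :: "tm \<Rightarrow> ((nat \<Rightarrow>\<^sub>0 nat) \<Rightarrow>\<^sub>0 int)" where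
  "tm_poly (Var i) = Poly_Mapping.single (Poly_Mapping.single i 1) 1"
| "tm_poly Zero = 0"
| "tm_poly One = 1"
| "tm_poly (Add s t) = tm_poly s + tm_poly t"
| "tm_poly (Sub s t) = tm_poly s - tm_poly t"
| "tm_poly (Mul s t) = tm_poly s * tm_poly t"

definition homogeneous_in :: "'v set \<Rightarrow> (('v \<Rightarrow>\<^sub>0 nat) \<Rightarrow>\<^sub>0 'a::zero) \<Rightarrow> bool" where
  "homogeneous_in Z q \<longleftrightarrow>
     (\<exists>d. \<forall>m \<in> Poly_Mapping.keys q. (\<Sum>v \<in> Poly_Mapping.keys m \<inter> Z. Poly_Mapping.lookup m v) = d)"

text \<open>\<open>\<exists>\<zeta> \<in> P\<^sup>r (\<not> \<zeta> = 0 \<and> \<And>\<^sub>j t\<^sub>j(x, \<zeta>) = 0)\<close>, where \<open>x\<close> is the tuple of variables \<open>0, \<dots>, k - 1\<close>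
  and \<open>\<zeta>\<close> is the tuple of variables \<open>k, \<dots>, k + r - 1\<close>.\<close>

definition tame_fm :: "nat \<Rightarrow> nat \<Rightarrow> tm list \<Rightarrow> p_atom fm" where
  "tame_fm k r ts =
     (let zs = [k..<k + r] in
      exs zs
        (Conj (conjs (map (\<lambda>z. Atom (InP (Var z))) zs))
        (Conj (Neg (conjs (map (\<lambda>z. Atom (Eq (Var z) Zero)) zs)))
              (conjs (map (\<lambda>t. Atom (Eq t Zero)) ts)))))"

text \<open>Tame formulas in the free variables \<open>0, \<dots>, k - 1\<close>. An integer polynomial occurs in a formula
  through a term denoting it; every integer polynomial is \<open>tm_poly t\<close> for some term \<open>t\<close> in the
  same variables.\<close>

definition tame :: "nat \<Rightarrow> p_atom fm \<Rightarrow> bool" where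
  "tame k \<phi> \<longleftrightarrow>
     (\<exists>r ts. \<phi> = tame_fm k r ts \<and>
        (\<forall>t \<in> set ts. tm_vars t \<subseteq> {..<k + r} \<and> homogeneous_in {k..<k + r} (tm_poly t)))"


section \<open>Kolchin-closed sets\<close>

text \<open>A differential polynomial is a polynomial in the variables \<open>(i, j)\<close>, where \<open>(i, j)\<close> stands
  for the \<open>j\<close>-th derivative of the indeterminate \<open>x\<^sub>i\<close>.\<close>

type_synonym 'a diff_poly = "((nat \<times> nat) \<Rightarrow>\<^sub>0 nat) \<Rightarrow>\<^sub>0 'a"

definition diff_poly_in :: "nat \<Rightarrow> ('a::zero) diff_poly \<Rightarrow> bool" where
  "diff_poly_in n p \<longleftrightarrow> (\<forall>m \<in> Poly_Mapping.keys p. \<forall>(i, j) \<in> Poly_Mapping.keys m. i < n)"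

definition diff_poly_val ::
    "('a::comm_ring_1 \<Rightarrow> 'a) \<Rightarrow> 'a list \<Rightarrow> 'a diff_poly \<Rightarrow> 'a" where
  "diff_poly_val \<delta> a p =
     (\<Sum>m \<in> Poly_Mapping.keys p. Poly_Mapping.lookup p m *
        (\<Prod>(i, j) \<in> Poly_Mapping.keys m. (\<delta> ^^ j) (a ! i) ^ Poly_Mapping.lookup m (i, j)))"

text \<open>\<open>K\<^sup>n\<close> is the set of lists of length \<open>n\<close>. The system \<open>F\<close> of equations may be infinite.\<close>

definition Kolchin_closed :: "('a::comm_ring_1 \<Rightarrow> 'a) \<Rightarrow> nat \<Rightarrow> 'a list set \<Rightarrow> bool" where
  "Kolchin_closed \<delta> n S \<longleftrightarrow>
     (\<exists>F. (\<forall>p \<in> F. diff_poly_in n p) \<and>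
          S = {a. length a = n \<and> (\<forall>p \<in> F. diff_poly_val \<delta> a p = 0)})"

end

theory Submission
  imports Defs "HOL-Library.Multiset"
begin

text \<open>
  Write \<open>E\<close> for the field of constants of \<open>K\<close>. For a fixed tuple \<open>a\<close> the tame formula asks for a
  nonzero point of \<open>E\<^sup>r\<close> on the projective variety cut out by forms
  \<open>q\<^sub>j(a, b, \<zeta>)\<close> in \<open>\<zeta>\<close>, whose coefficients lie in \<open>K\<close> and depend polynomially on \<open>a\<close>. The
  existential quantifier over \<open>\<zeta>\<close> is removed in three moves.

  The first move makes the problem linear. By \<open>homogeneous_Nullstellensatz\<close> a common zero exists
  iff in every degree \<open>N\<close> there is a nonzero functional, with values in \<open>E\<close> on the monomials of
  degree \<open>N\<close>, that annihilates all multiples of degree \<open>N\<close> of the forms by monomials. Evaluation at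
  a common zero is such a functional. Conversely, the functionals annihilating the ideal form a
  family of spaces stable under the shifts \<open>f \<mapsto> f(X\<^sub>i \<cdot> -)\<close>, Macaulay's inverse system of the ideal.
  If it is nonzero in every degree, it can be shrunk, keeping this property, to the kernels of
  \<open>X\<^sub>j - t\<^sub>j X\<^sub>x\<close> for a fixed \<open>x\<close> and suitable \<open>t\<^sub>j \<in> E\<close>, and then all that remains is evaluation
  at \<open>t\<close>. The scalars \<open>t\<^sub>j\<close> are eigenvalues, and they lie in \<open>E\<close> because \<open>E\<close> is algebraically
  closed in the algebraically closed field \<open>K\<close>.

  The second move trades constants for derivatives. If \<open>f\<close> has constant entries, then
  \<open>\<Sum> f\<^sub>\<beta> v\<^sub>\<beta> = 0\<close> can be differentiated to \<open>\<Sum> f\<^sub>\<beta> \<delta>\<^sup>k(v\<^sub>\<beta>) = 0\<close> for all \<open>k\<close>. Conversely, the space of all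
  \<open>f\<close> over \<open>K\<close> satisfying these equations is stable under \<open>\<delta>\<close>, so that a nonzero element of minimal
  support with one entry equal to \<open>1\<close> is constant. This is \<open>constant_annihilator_iff\<close>.

  The third move is Gaussian elimination. The existence of a nontrivial solution over \<open>K\<close> of a
  system of homogeneous linear equations in a fixed finite number of unknowns is a closed condition
  on the coefficients (\<open>zero_locus_linear_dependence\<close>); here the coefficients are the derivatives of
  polynomials in \<open>a\<close> and \<open>b\<close>, that is, differential polynomial functions of \<open>a\<close>. The set in question
  is the intersection of these closed sets over all degrees \<open>N\<close>.
\<close>

section \<open>Linear algebra over an algebraically closed subfield\<close>

text \<open>Since the ambient field is algebraically closed, being closed under roots makes \<open>E\<close> an
  algebraically closed field. It stays a set rather than a type because it will depend on the
  derivation.\<close>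

locale root_closed_subfield =
  fixes E :: "'a::alg_closed_field set"
  assumes zero_in [simp, intro]: "0 \<in> E"
    and one_in [simp, intro]: "1 \<in> E"
    and add_in [intro]: "x \<in> E \<Longrightarrow> y \<in> E \<Longrightarrow> x + y \<in> E"
    and mult_in [intro]: "x \<in> E \<Longrightarrow> y \<in> E \<Longrightarrow> x * y \<in> E"
    and uminus_in [intro]: "x \<in> E \<Longrightarrow> - x \<in> E"
    and inverse_in [intro]: "x \<in> E \<Longrightarrow> inverse x \<in> E"
    and root_in: "p \<noteq> 0 \<Longrightarrow> (\<And>k. coeff p k \<in> E) \<Longrightarrow> poly p t = 0 \<Longrightarrow> t \<in> E"
begin

lemma diff_in [intro]: "x \<in> E \<Longrightarrow> y \<in> E \<Longrightarrow> x - y \<in> E"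
  using add_in[of x "- y"] by auto

lemma divide_in [intro]: "x \<in> E \<Longrightarrow> y \<in> E \<Longrightarrow> x / y \<in> E"
  by (auto simp: field_class.field_divide_inverse)

lemma sum_in [intro]: "(\<And>x. x \<in> A \<Longrightarrow> f x \<in> E) \<Longrightarrow> sum f A \<in> E"
  by (induction A rule: infinite_finite_induct) auto

text \<open>A homogeneous linear system over \<open>E\<close> with more unknowns than equations: solve one equation for
  an unknown occurring in it, substitute into the others, and induct on the number of equations.
  Below it takes the role of the dimension over \<open>E\<close> of spaces of functionals.\<close>

lemma nontrivial_linear_dependence:
  assumes "finite B" "finite S" "card B < card S" "\<And>s b. v s b \<in> E"
  obtains c where "\<And>s. c s \<in> E" "\<exists>s\<in>S. c s \<noteq> 0" "\<And>b. b \<in> B \<Longrightarrow> (\<Sum>s\<in>S. c s * v s b) = 0"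
proof -
  have "\<exists>c. (\<forall>s. c s \<in> E) \<and> (\<exists>s\<in>S. c s \<noteq> 0) \<and> (\<forall>b\<in>B. (\<Sum>s\<in>S. c s * v s b) = 0)"
    using assms
  proof (induction B arbitrary: S v rule: finite_induct)
    case empty
    then show ?case
      by (intro exI[of _ "\<lambda>_. 1"]) (auto simp: card_gt_0_iff)
  next
    case (insert b B)
    show ?case
    proof (cases "\<forall>s\<in>S. v s b = 0")
      case True
      have "card B < card S"
        using insert by simp
      then obtain c where "\<forall>s. c s \<in> E" "\<exists>s\<in>S. c s \<noteq> 0" "\<forall>b\<in>B. (\<Sum>s\<in>S. c s * v s b) = 0"
        using insert.IH[of S v] insert.prems by blast
      then show ?thesis
        using True by (intro exI[of _ c]) auto
    next
      case False
      then obtain s0 where s0: "s0 \<in> S" "v s0 b \<noteq> 0"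
        by blast
      define S' where "S' = S - {s0}"
      define v' where "v' s \<beta> = v s \<beta> - v s b / v s0 b * v s0 \<beta>" for s \<beta>
      have "card B < card S'" "finite S'"
        using insert s0 by (auto simp: S'_def)
      moreover have "v' s \<beta> \<in> E" for s \<beta>
        unfolding v'_def using insert.prems by blast
      ultimately obtain c where c: "\<And>s. c s \<in> E" "\<exists>s\<in>S'. c s \<noteq> 0"
          "\<And>\<beta>. \<beta> \<in> B \<Longrightarrow> (\<Sum>s\<in>S'. c s * v' s \<beta>) = 0"
        using insert.IH[of S' v'] by blast
      define d where "d = - (\<Sum>s\<in>S'. c s * v s b) / v s0 b"
      have "d \<in> E"
        unfolding d_def using c insert.prems by blast
      have split: "(\<Sum>s\<in>S. (c(s0 := d)) s * v s \<beta>) = d * v s0 \<beta> + (\<Sum>s\<in>S'. c s * v s \<beta>)" for \<beta>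
      proof -
        have "(\<Sum>s\<in>S. (c(s0 := d)) s * v s \<beta>) = d * v s0 \<beta> + (\<Sum>s\<in>S'. (c(s0 := d)) s * v s \<beta>)"
          unfolding S'_def by (subst sum.remove[OF insert.prems(1) s0(1)]) simp
        also have "(\<Sum>s\<in>S'. (c(s0 := d)) s * v s \<beta>) = (\<Sum>s\<in>S'. c s * v s \<beta>)"
          by (intro sum.cong) (auto simp: S'_def)
        finally show ?thesis .
      qed
      have "(\<Sum>s\<in>S. (c(s0 := d)) s * v s \<beta>) = 0" if "\<beta> \<in> insert b B" for \<beta>
      proof (cases "\<beta> = b")
        case True
        then show ?thesis
          unfolding split using s0 by (simp add: d_def)
      next
        case False
        then have "0 = (\<Sum>s\<in>S'. c s * v' s \<beta>)"
          using c that by auto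
        also have "\<dots> = (\<Sum>s\<in>S'. c s * v s \<beta>) - (\<Sum>s\<in>S'. c s * v s b) / v s0 b * v s0 \<beta>"
          by (simp add: v'_def algebra_simps sum_subtractf sum_distrib_left sum_divide_distrib)
        finally show ?thesis
          unfolding split by (simp add: d_def)
      qed
      moreover have "\<exists>s\<in>S. (c(s0 := d)) s \<noteq> 0"
        using c(2) by (auto simp: S'_def)
      ultimately show ?thesis
        using c \<open>d \<in> E\<close> by (intro exI[of _ "c(s0 := d)"]) auto
    qed
  qed
  then show ?thesis
    using that by blast
qed

text \<open>Synthetic division computes the coefficients of the quotient from the top down, within \<open>E\<close>.\<close>

lemma coeff_quotient_in:
  assumes "\<And>k. coeff ([:-t, 1:] * q) k \<in> E" "t \<in> E"
  shows "coeff q k \<in> E"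
proof (induction "Suc (degree q) - k" arbitrary: k)
  case 0
  then show ?case
    by (simp add: coeff_eq_0)
next
  case (Suc n)
  then have "coeff q (Suc k) \<in> E"
    by simp
  moreover have "coeff q k = coeff ([:-t, 1:] * q) (Suc k) + t * coeff q (Suc k)"
    by (simp add: coeff_pCons)
  ultimately show ?case
    using assms by (metis add_in mult_in)
qed

end

section \<open>Functionals on homogeneous polynomials\<close>

text \<open>A multiset of indices is a monomial, and a function on multisets is a linear functional on
  polynomials, given by its values on monomials. The adjoint of multiplication by \<open>X\<^sub>i\<close> is a shift.\<close>

definition shift :: "'i \<Rightarrow> ('i multiset \<Rightarrow> 'a) \<Rightarrow> 'i multiset \<Rightarrow> 'a" where
  "shift i f = (\<lambda>m. f (add_mset i m))"

text \<open>The action of \<open>\<Sum>\<^sub>k p\<^sub>k X\<^sub>x\<^bsup>D-k\<^esup> X\<^sub>y\<^bsup>k\<^esup>\<close>, the homogenisation of \<open>p\<close> in degree \<open>D\<close>, on a functional through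
  the shifts.\<close>

definition binary_form ::
    "'a::comm_ring_1 poly \<Rightarrow> nat \<Rightarrow> 'i \<Rightarrow> 'i \<Rightarrow> ('i multiset \<Rightarrow> 'a) \<Rightarrow> 'i multiset \<Rightarrow> 'a" where
  "binary_form p D x y f =
     (\<lambda>m. \<Sum>k\<le>D. coeff p k * f (replicate_mset (D - k) x + replicate_mset k y + m))"

text \<open>A linear factor \<open>T - t\<close> of \<open>p\<close> acts as \<open>X\<^sub>y - t X\<^sub>x\<close>. Dividing a polynomial that annihilates \<open>f\<close> by
  its linear factors one at a time therefore produces an eigenvector.\<close>

lemma binary_form_linear_factor:
  assumes "degree q \<le> D"
  shows "binary_form ([:-t, 1:] * q) (Suc D) x y f m =
           binary_form q D x y f (add_mset y m) - t * binary_form q D x y f (add_mset x m)"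
proof -
  let ?M = "\<lambda>k. f (replicate_mset (Suc D - k) x + replicate_mset k y + m)"
  have "coeff ([:-t, 1:] * q) k = coeff (pCons 0 q) k - t * coeff q k" for k
    by (simp add: coeff_pCons split: nat.split)
  then have "binary_form ([:-t, 1:] * q) (Suc D) x y f m =
      (\<Sum>k\<le>Suc D. coeff (pCons 0 q) k * ?M k) - (\<Sum>k\<le>Suc D. t * coeff q k * ?M k)"
    by (simp add: binary_form_def algebra_simps sum_subtractf del: sum.atMost_Suc)
  also have "(\<Sum>k\<le>Suc D. coeff (pCons 0 q) k * ?M k) = binary_form q D x y f (add_mset y m)"
    by (subst sum.atMost_Suc_shift) (simp add: binary_form_def)
  also have "(\<Sum>k\<le>Suc D. t * coeff q k * ?M k) = t * binary_form q D x y f (add_mset x m)"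
  proof -
    have "coeff q (Suc D) = 0"
      using assms by (intro coeff_eq_0) simp
    then have "(\<Sum>k\<le>Suc D. t * coeff q k * ?M k) = (\<Sum>k\<le>D. t * coeff q k * ?M k)"
      by simp
    also have "\<dots> = t * binary_form q D x y f (add_mset x m)"
      unfolding binary_form_def sum_distrib_left
      by (intro sum.cong) (auto simp: Suc_diff_le mult.assoc)
    finally show ?thesis .
  qed
  finally show ?thesis .
qed

text \<open>On a functional on which \<open>X\<^sub>y\<close> acts as \<open>s X\<^sub>x\<close>, the form \<open>p\<close> acts as \<open>p(s) X\<^sub>x\<^sup>D\<close>. Polynomials with
  prescribed roots thus separate eigenvectors with different eigenvalues.\<close>

lemma binary_form_eigenvector:
  assumes "degree p \<le> D" "\<And>m. f (add_mset y m) = s * f (add_mset x m)"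
  shows "binary_form p D x y f m = poly p s * f (replicate_mset D x + m)"
proof -
  have *: "f (replicate_mset k y + m) = s ^ k * f (replicate_mset k x + m)" for k m
  proof (induction k arbitrary: m)
    case (Suc k)
    have "f (replicate_mset (Suc k) y + m) = s * f (replicate_mset k y + add_mset x m)"
      by (simp add: assms(2))
    also have "\<dots> = s ^ Suc k * f (replicate_mset (Suc k) x + m)"
      using Suc.IH[of "add_mset x m"] by (simp add: mult.assoc)
    finally show ?case .
  qed simp
  have "f (replicate_mset (D - k) x + replicate_mset k y + m) = s ^ k * f (replicate_mset D x + m)"
    if "k \<le> D" for k
  proof -
    have "f (replicate_mset (D - k) x + replicate_mset k y + m) =
        f (replicate_mset k y + (replicate_mset (D - k) x + m))"
      by (simp add: ac_simps)
    also have "\<dots> = s ^ k * f (replicate_mset k x + (replicate_mset (D - k) x + m))"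
      by (rule *)
    also have "replicate_mset k x + (replicate_mset (D - k) x + m) = replicate_mset D x + m"
      using that by (intro multiset_eqI) auto
    finally show ?thesis .
  qed
  then have "binary_form p D x y f m = (\<Sum>k\<le>D. coeff p k * s ^ k) * f (replicate_mset D x + m)"
    by (simp add: binary_form_def sum_distrib_right mult.assoc)
  also have "(\<Sum>k\<le>D. coeff p k * s ^ k) = poly p s"
    unfolding poly_altdef using assms(1)
    by (intro sum.mono_neutral_right) (auto simp: coeff_eq_0)
  finally show ?thesis .
qed

context root_closed_subfield
begin

definition homogeneous_functionals :: "'i set \<Rightarrow> nat \<Rightarrow> ('i multiset \<Rightarrow> 'a) set" where
  "homogeneous_functionals I n =
     {f. range f \<subseteq> E \<and> (\<forall>m. f m \<noteq> 0 \<longrightarrow> m \<in> multisets_of_size I n)}"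

text \<open>Macaulay's name for a space of functionals stable under all shifts; the functionals that
  annihilate an ideal form such a space.\<close>

definition inverse_system :: "'i set \<Rightarrow> ('i multiset \<Rightarrow> 'a) set \<Rightarrow> bool" where
  "inverse_system I W \<longleftrightarrow>
     (\<forall>a\<in>E. \<forall>b\<in>E. \<forall>f\<in>W. \<forall>g\<in>W. (\<lambda>m. a * f m + b * g m) \<in> W) \<and>
     (\<forall>i\<in>I. \<forall>f\<in>W. shift i f \<in> W)"

text \<open>If \<open>W\<close> is the annihilator of a homogeneous ideal, this says that the ideal is proper in every
  degree: it contains no power of the irrelevant ideal.\<close>

definition persistent :: "'i set \<Rightarrow> ('i multiset \<Rightarrow> 'a) set \<Rightarrow> bool" where
  "persistent I W \<longleftrightarrow> (\<forall>n. \<exists>f \<in> W \<inter> homogeneous_functionals I n. f \<noteq> (\<lambda>_. 0))"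

lemma homogeneous_functionalsI:
  assumes "\<And>m. f m \<in> E" "\<And>m. f m \<noteq> 0 \<Longrightarrow> set_mset m \<subseteq> I \<and> size m = n"
  shows "f \<in> homogeneous_functionals I n"
  using assms unfolding homogeneous_functionals_def multisets_of_size_def by blast

lemma homogeneous_functionals_value: "f \<in> homogeneous_functionals I n \<Longrightarrow> f m \<in> E"
  unfolding homogeneous_functionals_def by blast

lemma homogeneous_functionals_support:
  "f \<in> homogeneous_functionals I n \<Longrightarrow> f m \<noteq> 0 \<Longrightarrow> set_mset m \<subseteq> I \<and> size m = n"
  unfolding homogeneous_functionals_def multisets_of_size_def by blast

lemma homogeneous_translate:
  assumes "f \<in> homogeneous_functionals I (size \<nu> + n)"
  shows "(\<lambda>m. f (\<nu> + m)) \<in> homogeneous_functionals I n"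
proof (rule homogeneous_functionalsI)
  show "f (\<nu> + m) \<in> E" for m
    by (rule homogeneous_functionals_value[OF assms])
  show "set_mset m \<subseteq> I \<and> size m = n" if "f (\<nu> + m) \<noteq> 0" for m
    using homogeneous_functionals_support[OF assms that] by simp
qed

lemma shift_homogeneous:
  "f \<in> homogeneous_functionals I (Suc n) \<Longrightarrow> shift i f \<in> homogeneous_functionals I n"
  using homogeneous_translate[of f I "{#i#}" n] by (simp add: shift_def)

text \<open>A monomial of positive degree is divisible by a variable. Nonzero elements of high degree in an
  inverse system hence give nonzero elements in all lower degrees.\<close>

lemma nonzero_shift:
  assumes "f \<in> homogeneous_functionals I (Suc n)" "f \<noteq> (\<lambda>_. 0)"
  obtains i where "i \<in> I" "shift i f \<noteq> (\<lambda>_. 0)"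
proof -
  obtain m where m: "f m \<noteq> 0"
    using assms(2) by auto
  then have "size m = Suc n" "set_mset m \<subseteq> I"
    using homogeneous_functionals_support[OF assms(1)] by auto
  then obtain i m' where "m = add_mset i m'"
    by (metis size_eq_Suc_imp_eq_union)
  then have "i \<in> I" "shift i f m' \<noteq> 0"
    using m \<open>set_mset m \<subseteq> I\<close> by (auto simp: shift_def)
  then show ?thesis
    using that by metis
qed

lemma inverse_system_combination:
  "inverse_system I W \<Longrightarrow> a \<in> E \<Longrightarrow> b \<in> E \<Longrightarrow> f \<in> W \<Longrightarrow> g \<in> W \<Longrightarrow> (\<lambda>m. a * f m + b * g m) \<in> W"
  by (simp add: inverse_system_def)

lemma inverse_system_shift: "inverse_system I W \<Longrightarrow> i \<in> I \<Longrightarrow> f \<in> W \<Longrightarrow> shift i f \<in> W"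
  by (simp add: inverse_system_def)

lemma inverse_system_zero:
  assumes "inverse_system I W" "f \<in> W"
  shows "(\<lambda>_. 0) \<in> W"
  using inverse_system_combination[OF assms(1), of 0 0 f f] assms(2) by simp

lemma inverse_system_sum:
  assumes "inverse_system I W" "h \<in> W" "\<And>s. s \<in> S \<Longrightarrow> c s \<in> E" "\<And>s. s \<in> S \<Longrightarrow> g s \<in> W"
  shows "(\<lambda>m. \<Sum>s\<in>S. c s * g s m) \<in> W"
  using assms(3,4)
proof (induction S rule: infinite_finite_induct)
  case (insert s S)
  have "(\<lambda>m. c s * g s m + 1 * (\<Sum>s\<in>S. c s * g s m)) \<in> W"
    by (rule inverse_system_combination[OF assms(1)]) (use insert in auto)
  then show ?case
    using insert by simp
qed (use inverse_system_zero[OF assms(1,2)] in auto)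

lemma inverse_system_translate:
  assumes "inverse_system I W" "f \<in> W" "set_mset \<nu> \<subseteq> I"
  shows "(\<lambda>m. f (\<nu> + m)) \<in> W"
  using assms(3)
proof (induction \<nu>)
  case empty
  then show ?case
    using assms(2) by simp
next
  case (add i \<nu>)
  then have "shift i (\<lambda>m. f (\<nu> + m)) \<in> W"
    using inverse_system_shift[OF assms(1)] by simp
  then show ?case
    by (simp add: shift_def)
qed

lemma homogeneous_sum:
  assumes "\<And>s. s \<in> S \<Longrightarrow> c s \<in> E" "\<And>s. s \<in> S \<Longrightarrow> g s \<in> homogeneous_functionals I n"
  shows "(\<lambda>m. \<Sum>s\<in>S. c s * g s m) \<in> homogeneous_functionals I n"
proof (rule homogeneous_functionalsI)
  show "(\<Sum>s\<in>S. c s * g s m) \<in> E" for m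
    by (intro sum_in mult_in assms(1) homogeneous_functionals_value[OF assms(2)])
  show "set_mset m \<subseteq> I \<and> size m = n" if nz: "(\<Sum>s\<in>S. c s * g s m) \<noteq> 0" for m
  proof -
    obtain s where "s \<in> S" "g s m \<noteq> 0"
      using nz by (metis (no_types, lifting) mult_zero_right sum.neutral)
    then show ?thesis
      using homogeneous_functionals_support[OF assms(2)] by blast
  qed
qed

lemma binary_form_inverse_system:
  assumes "inverse_system I W" "f \<in> W" "x \<in> I" "y \<in> I" "\<And>k. coeff p k \<in> E"
  shows "binary_form p D x y f \<in> W"
  unfolding binary_form_def
  by (intro inverse_system_sum[OF assms(1,2)] inverse_system_translate[OF assms(1,2)])
    (use assms in \<open>auto split: if_splits\<close>)

lemma binary_form_homogeneous:
  assumes "f \<in> homogeneous_functionals I (D + n)" "\<And>k. coeff p k \<in> E"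
  shows "binary_form p D x y f \<in> homogeneous_functionals I n"
  unfolding binary_form_def
  by (intro homogeneous_sum homogeneous_translate) (use assms in auto)

lemma inverse_system_descend:
  assumes "inverse_system I W" "f \<in> W \<inter> homogeneous_functionals I m" "f \<noteq> (\<lambda>_. 0)" "n \<le> m"
  shows "\<exists>g \<in> W \<inter> homogeneous_functionals I n. g \<noteq> (\<lambda>_. 0)"
  using assms(4,2,3)
proof (induction m arbitrary: f rule: dec_induct)
  case (step m)
  then obtain i where "i \<in> I" "shift i f \<noteq> (\<lambda>_. 0)"
    using nonzero_shift by blast
  moreover have "shift i f \<in> W \<inter> homogeneous_functionals I m"
    using step.prems(1) inverse_system_shift[OF assms(1) \<open>i \<in> I\<close>] shift_homogeneous by auto
  ultimately show ?case
    by (intro step.IH)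
qed blast

text \<open>The kernel of a linear form is stable under the shifts, because shifts commute.\<close>

lemma inverse_system_kernel:
  assumes "inverse_system I W"
  shows "inverse_system I (W \<inter> {f. \<forall>m. a * f (add_mset x m) = b * f (add_mset y m)})"
  unfolding inverse_system_def
proof (intro conjI ballI)
  let ?Z = "{f. \<forall>m. a * f (add_mset x m) = b * f (add_mset y m)}"
  fix c d f g
  assume c: "c \<in> E" "d \<in> E" and f: "f \<in> W \<inter> ?Z" and g: "g \<in> W \<inter> ?Z"
  have "a * (c * f (add_mset x m) + d * g (add_mset x m)) =
      b * (c * f (add_mset y m) + d * g (add_mset y m))" for m
  proof -
    have "a * f (add_mset x m) = b * f (add_mset y m)" "a * g (add_mset x m) = b * g (add_mset y m)"
      using f g by auto
    then show ?thesis
      by algebra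
  qed
  then show "(\<lambda>m. c * f m + d * g m) \<in> W \<inter> ?Z"
    using inverse_system_combination[OF assms c] f g by blast
next
  let ?Z = "{f. \<forall>m. a * f (add_mset x m) = b * f (add_mset y m)}"
  fix i f
  assume i: "i \<in> I" and f: "f \<in> W \<inter> ?Z"
  have "a * f (add_mset x (add_mset i m)) = b * f (add_mset y (add_mset i m))" for m
    using f by auto
  then have "shift i f \<in> ?Z"
    by (simp add: shift_def add_mset_commute)
  then show "shift i f \<in> W \<inter> ?Z"
    using inverse_system_shift[OF assms i] f by blast
qed

end

section \<open>A homogeneous Nullstellensatz over the subfield\<close>

context root_closed_subfield
begin

lemma not_persistent_eventually_zero:
  assumes "inverse_system I W" "\<not> persistent I W"
  shows "\<exists>N. \<forall>n\<ge>N. \<forall>f \<in> W \<inter> homogeneous_functionals I n. f = (\<lambda>_. 0)"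
proof -
  obtain N where N: "\<forall>f \<in> W \<inter> homogeneous_functionals I N. f = (\<lambda>_. 0)"
    using assms(2) unfolding persistent_def by blast
  have "f = (\<lambda>_. 0)" if "n \<ge> N" "f \<in> W \<inter> homogeneous_functionals I n" for n f
  proof (rule ccontr)
    assume "f \<noteq> (\<lambda>_. 0)"
    then show False
      using inverse_system_descend[OF assms(1) that(2) _ that(1)] N by blast
  qed
  then show ?thesis
    by blast
qed

lemma persistent_mono: "persistent I V \<Longrightarrow> V \<subseteq> W \<Longrightarrow> persistent I W"
  unfolding persistent_def by blast

lemma inverse_system_annihilated:
  "inverse_system I W \<Longrightarrow> inverse_system I (W \<inter> {f. \<forall>m. f (add_mset x m) = 0})"
  using inverse_system_kernel[of I W 1 x 0 x] by simp

lemma inverse_system_eigenspace: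
  "inverse_system I W \<Longrightarrow> inverse_system I (W \<inter> {f. \<forall>m. f (add_mset y m) = t * f (add_mset x m)})"
  using inverse_system_kernel[of I W 1 y t x] by simp

text \<open>Read on quotient rings: if the ideal stays proper in all degrees, but adding \<open>X\<^sub>x\<close> makes it improper
  in some degree, then some \<open>X\<^sub>y - t X\<^sub>x\<close> can be added without losing properness.

  By assumption \<open>X\<^sub>x\<close> acts injectively from some degree \<open>N\<close> on, so that the spaces in higher degrees
  embed into the one of degree \<open>N\<close>, and their dimensions are bounded by the number \<open>D\<close> of monomials of
  degree \<open>N\<close>. Consequently the \<open>D + 1\<close> functionals \<open>X\<^sub>x\<^bsup>D-k\<^esup> X\<^sub>y\<^bsup>k\<^esup> f\<close> are dependent, which yields an
  eigenvalue in every degree, and in high degree \<open>D + 1\<close> eigenvectors with different eigenvalues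
  are impossible. The sets of eigenvalues in degree \<open>n\<close> decrease with \<open>n\<close>; being nonempty and
  eventually finite, they have a common element.\<close>

lemma persistent_eigenspace:
  assumes "finite I" and sys: "inverse_system I W" and pers: "persistent I W"
    and "x \<in> I" "y \<in> I" and x: "\<not> persistent I (W \<inter> {f. \<forall>m. f (add_mset x m) = 0})"
  obtains t where "t \<in> E" "persistent I (W \<inter> {f. \<forall>m. f (add_mset y m) = t * f (add_mset x m)})"
proof -
  obtain h where h: "h \<in> W"
    using pers unfolding persistent_def by blast
  obtain N where N0: "\<forall>n\<ge>N. \<forall>f \<in> (W \<inter> {f. \<forall>m. f (add_mset x m) = 0}) \<inter> homogeneous_functionals I n.
      f = (\<lambda>_. 0)"
    using not_persistent_eventually_zero[OF inverse_system_annihilated[OF sys] x] ..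
  have N: "f = (\<lambda>_. 0)"
    if "n \<ge> N" "f \<in> W \<inter> homogeneous_functionals I n" "\<forall>m. f (add_mset x m) = 0" for n f
    using N0[rule_format, OF that(1)] that(2,3) by blast
  \<comment> \<open>Powers of \<open>X\<^sub>x\<close> are injective as long as the degree does not drop below \<open>N\<close>.\<close>
  have inj: "f = (\<lambda>_. 0)" if "f \<in> W \<inter> homogeneous_functionals I n" "N + D \<le> n"
      "\<And>m. f (replicate_mset D x + m) = 0" for f n D
    using that
  proof (induction D arbitrary: f n)
    case 0
    then show ?case
      by (auto simp: fun_eq_iff)
  next
    case (Suc D)
    then obtain n' where n': "n = Suc n'"
      by (cases n) auto
    have "shift x f = (\<lambda>_. 0)"
    proof (rule Suc.IH)
      show "shift x f \<in> W \<inter> homogeneous_functionals I n'"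
        using Suc.prems(1) inverse_system_shift[OF sys \<open>x \<in> I\<close>, of f] shift_homogeneous[of f I n' x] n'
        by simp
      show "N + D \<le> n'"
        using Suc.prems n' by simp
      show "shift x f (replicate_mset D x + m) = 0" for m
        using Suc.prems(3)[of m] by (simp add: shift_def)
    qed
    then have "\<forall>m. f (add_mset x m) = 0"
      by (simp add: shift_def fun_eq_iff)
    then show ?case
      using N[of n f] Suc.prems by simp
  qed
  define B where "B = multisets_of_size I N"
  define D where "D = card B"
  have "finite B"
    unfolding B_def using \<open>finite I\<close> by (rule finite_multisets_of_size)
  \<comment> \<open>Multiply by a power of \<open>X\<^sub>x\<close> to reach degree \<open>N\<close>, find a dependence there, and go back by
    injectivity.\<close>
  have dep: "\<exists>c. (\<forall>s. c s \<in> E) \<and> (\<exists>s\<in>S. c s \<noteq> 0) \<and> (\<forall>m. (\<Sum>s\<in>S. c s * g s m) = 0)"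
    if n: "N \<le> n" and S: "finite S" "D < card S"
      and g: "\<And>s. s \<in> S \<Longrightarrow> g s \<in> W \<inter> homogeneous_functionals I n"
    for n and S :: "'s set" and g
  proof -
    define v where "v s b = (if s \<in> S then g s (replicate_mset (n - N) x + b) else 0)" for s b
    have "v s b \<in> E" for s b
      using g homogeneous_functionals_value unfolding v_def by fastforce
    then obtain c where c: "\<And>s. c s \<in> E" "\<exists>s\<in>S. c s \<noteq> 0"
        "\<And>b. b \<in> B \<Longrightarrow> (\<Sum>s\<in>S. c s * v s b) = 0"
      using nontrivial_linear_dependence[OF \<open>finite B\<close> \<open>finite S\<close>] S(2) unfolding D_def by blast
    define f where "f = (\<lambda>m. \<Sum>s\<in>S. c s * g s m)"
    have f: "f \<in> W \<inter> homogeneous_functionals I n"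
    proof
      show "f \<in> W"
        unfolding f_def by (rule inverse_system_sum[OF sys h c(1)]) (use g in blast)
      show "f \<in> homogeneous_functionals I n"
        unfolding f_def by (rule homogeneous_sum[OF c(1)]) (use g in blast)
    qed
    have "f (replicate_mset (n - N) x + m) = 0" for m
    proof (cases "m \<in> B")
      case True
      then show ?thesis
        using c(3)[of m] by (simp add: f_def v_def)
    next
      case False
      have "(\<lambda>m. f (replicate_mset (n - N) x + m)) \<in> homogeneous_functionals I N"
        by (rule homogeneous_translate) (use f n in simp)
      then show ?thesis
        using False homogeneous_functionals_support[of _ I N m]
        unfolding B_def multisets_of_size_def by blast
    qed
    then have "f = (\<lambda>_. 0)"
      by (intro inj[OF f, of "n - N"]) (use n in auto)
    then have "\<forall>m. (\<Sum>s\<in>S. c s * g s m) = 0"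
      unfolding f_def by metis
    then show ?thesis
      using c by blast
  qed
  define K where "K t = W \<inter> {f. \<forall>m. f (add_mset y m) = t * f (add_mset x m)}" for t
  define T where "T n = {t \<in> E. \<exists>f \<in> K t \<inter> homogeneous_functionals I n. f \<noteq> (\<lambda>_. 0)}" for n
  have antimono: "T m \<subseteq> T n" if "n \<le> m" for n m
  proof
    fix t
    assume "t \<in> T m"
    then obtain f where f: "t \<in> E" "f \<in> K t \<inter> homogeneous_functionals I m" "f \<noteq> (\<lambda>_. 0)"
      unfolding T_def by blast
    have "\<exists>g \<in> K t \<inter> homogeneous_functionals I n. g \<noteq> (\<lambda>_. 0)"
      by (rule inverse_system_descend[OF _ f(2,3) that])
        (unfold K_def, rule inverse_system_eigenspace[OF sys])
    then show "t \<in> T n"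
      using f(1) unfolding T_def by blast
  qed
  \<comment> \<open>Split off linear factors of \<open>p\<close> as long as the remaining factor annihilates \<open>f\<close>. When it
    first does not, its action on \<open>f\<close> yields an eigenvector; if it always did, a power of \<open>X\<^sub>x\<close>
    would annihilate \<open>f\<close>.\<close>
  have eigenvalue: "T (Suc n) \<noteq> {}"
    if "degree p \<le> d" "p \<noteq> 0" "\<And>k. coeff p k \<in> E" "f \<in> W \<inter> homogeneous_functionals I (d + n)"
      "f \<noteq> (\<lambda>_. 0)" "N \<le> n" "\<And>m. binary_form p d x y f m = 0" for d n p f
    using that
  proof (induction d arbitrary: p n)
    case 0
    then have "coeff p 0 \<noteq> 0"
      using leading_coeff_neq_0[of p] by simp
    then have "f = (\<lambda>_. 0)"
      using 0(7) by (auto simp: binary_form_def)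
    then show ?case
      using 0(5) by simp
  next
    case (Suc d)
    show ?case
    proof (cases "degree p = 0")
      case True
      have "f (replicate_mset (Suc d) x + m) = 0" for m
      proof -
        have "(\<Sum>k\<in>{0}. coeff p k * f (replicate_mset (Suc d - k) x + replicate_mset k y + m)) =
            binary_form p (Suc d) x y f m"
          unfolding binary_form_def using True by (intro sum.mono_neutral_left) (auto simp: coeff_eq_0)
        then have "coeff p 0 * f (replicate_mset (Suc d) x + m) = 0"
          using Suc.prems(7)[of m] by simp
        then show ?thesis
          using True Suc.prems(2) leading_coeff_neq_0[of p] by auto
      qed
      then have "f = (\<lambda>_. 0)"
        by (intro inj[OF Suc.prems(4), of "Suc d"]) (use Suc.prems(6) in auto)
      then show ?thesis
        using Suc.prems(5) by simp
    next
      case False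
      then obtain t where t: "poly p t = 0"
        using alg_closed_imp_poly_has_root[of p] by blast
      then have "t \<in> E"
        using root_in Suc.prems by blast
      obtain q where q: "p = [:-t, 1:] * q"
        using t by (auto simp: poly_eq_0_iff_dvd dvd_def)
      have "q \<noteq> 0"
        using Suc.prems(2) q by auto
      then have "degree p = Suc (degree q)"
        unfolding q by (subst degree_mult_eq) auto
      then have deg: "degree q \<le> d"
        using Suc.prems(1) by simp
      have q_in: "coeff q k \<in> E" for k
        using coeff_quotient_in[of t q k] Suc.prems(3) \<open>t \<in> E\<close> unfolding q by blast
      define g where "g = binary_form q d x y f"
      have g: "g \<in> W \<inter> homogeneous_functionals I (Suc n)"
        unfolding g_def using Suc.prems(4)
          binary_form_inverse_system[OF sys _ \<open>x \<in> I\<close> \<open>y \<in> I\<close>, of f q d]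
          binary_form_homogeneous[of f I d "Suc n" q x y] q_in by simp
      have "g (add_mset y m) = t * g (add_mset x m)" for m
        using Suc.prems(7)[of m] binary_form_linear_factor[OF deg, of t x y f m]
        unfolding q g_def by simp
      then have "g \<in> K t"
        using g unfolding K_def by simp
      show ?thesis
      proof (cases "g = (\<lambda>_. 0)")
        case True
        then have "T (Suc (Suc n)) \<noteq> {}"
          using Suc.prems deg q_in \<open>q \<noteq> 0\<close> by (intro Suc.IH[of q]) (auto simp: g_def fun_eq_iff)
        then show ?thesis
          using antimono[of "Suc n" "Suc (Suc n)"] by auto
      next
        case False
        then show ?thesis
          using \<open>g \<in> K t\<close> g \<open>t \<in> E\<close> unfolding T_def by blast
      qed
    qed
  qed
  have nonempty: "T n \<noteq> {}" for n
  proof -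
    define M where "M = max n N"
    obtain f where f: "f \<in> W \<inter> homogeneous_functionals I (D + M)" "f \<noteq> (\<lambda>_. 0)"
      using pers unfolding persistent_def by blast
    define g where "g k = (\<lambda>m. f (replicate_mset (D - k) x + replicate_mset k y + m))" for k
    have "g k \<in> W \<inter> homogeneous_functionals I M" if "k \<in> {..D}" for k
      unfolding g_def
      using inverse_system_translate[OF sys, of f "replicate_mset (D - k) x + replicate_mset k y"]
        homogeneous_translate[of f I "replicate_mset (D - k) x + replicate_mset k y" M]
        that f \<open>x \<in> I\<close> \<open>y \<in> I\<close> by (auto split: if_splits)
    then obtain c where c: "\<And>k. c k \<in> E" "\<exists>k\<in>{..D}. c k \<noteq> 0" "\<And>m. (\<Sum>k\<le>D. c k * g k m) = 0"
      using dep[of M "{..D}" g] by (auto simp: M_def)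
    define p where "p = (\<Sum>k\<le>D. monom (c k) k)"
    have coeff_p: "coeff p k = (if k \<le> D then c k else 0)" for k
      by (simp add: p_def coeff_sum coeff_monom)
    have "T (Suc M) \<noteq> {}"
    proof (rule eigenvalue[of p D f])
      show "degree p \<le> D"
        by (intro degree_le) (simp add: coeff_p)
      show "p \<noteq> 0"
        using c(2) coeff_p by (metis atMost_iff coeff_0)
      show "coeff p k \<in> E" for k
        using c(1) by (simp add: coeff_p)
      show "N \<le> M"
        by (simp add: M_def)
      show "binary_form p D x y f m = 0" for m
        using c(3)[of m] by (simp add: binary_form_def g_def coeff_p)
    qed (fact f)+
    then show ?thesis
      using antimono[of n "Suc M"] by (auto simp: M_def)
  qed
  have finite_T: "finite (T (N + D))"
  proof (rule ccontr)
    assume "infinite (T (N + D))"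
    then obtain S where S: "finite S" "card S = Suc D" "S \<subseteq> T (N + D)"
      using infinite_arbitrarily_large by blast
    then have "\<forall>s\<in>S. \<exists>f. f \<in> K s \<inter> homogeneous_functionals I (N + D) \<and> f \<noteq> (\<lambda>_. 0)"
      unfolding T_def by blast
    then obtain g where g: "\<And>s. s \<in> S \<Longrightarrow> g s \<in> K s \<inter> homogeneous_functionals I (N + D)"
        "\<And>s. s \<in> S \<Longrightarrow> g s \<noteq> (\<lambda>_. 0)"
      by metis
    have gW: "\<And>s. s \<in> S \<Longrightarrow> g s \<in> W \<inter> homogeneous_functionals I (N + D)"
      using g(1) unfolding K_def by blast
    have "\<exists>c. (\<forall>s. c s \<in> E) \<and> (\<exists>s\<in>S. c s \<noteq> 0) \<and> (\<forall>m. (\<Sum>s\<in>S. c s * g s m) = 0)"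
      by (rule dep[OF _ S(1) _ gW]) (use S in auto)
    then obtain c s0 where c: "s0 \<in> S" "c s0 \<noteq> 0" "\<And>m. (\<Sum>s\<in>S. c s * g s m) = 0"
      by blast
    \<comment> \<open>Applied to the dependence, this polynomial leaves only the term of \<open>s0\<close>.\<close>
    define p where "p = (\<Prod>s\<in>S - {s0}. [:-s, 1:])"
    have poly_p: "poly p s = (\<Prod>u\<in>S - {s0}. s - u)" for s
      by (simp add: p_def poly_prod)
    have "degree p = D"
      unfolding p_def using S c(1) by (subst degree_prod_eq_sum_degree) auto
    have "g s0 (replicate_mset D x + m) = 0" for m
    proof -
      have "0 = (\<Sum>k\<le>D. coeff p k *
          (\<Sum>s\<in>S. c s * g s (replicate_mset (D - k) x + replicate_mset k y + m)))"
        using c(3) by simp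
      also have "\<dots> = (\<Sum>s\<in>S. c s * binary_form p D x y (g s) m)"
        unfolding binary_form_def sum_distrib_left by (subst sum.swap) (simp add: ac_simps)
      also have "\<dots> = (\<Sum>s\<in>S. c s * (poly p s * g s (replicate_mset D x + m)))"
        using g(1) \<open>degree p = D\<close> unfolding K_def
        by (intro sum.cong refl arg_cong2[of _ _ _ _ "(*)"] binary_form_eigenvector) auto
      also have "\<dots> = c s0 * (poly p s0 * g s0 (replicate_mset D x + m))"
        using c(1) S(1) by (subst sum.remove[of _ s0]) (auto intro!: sum.neutral simp: poly_p prod_zero_iff)
      finally show ?thesis
        using c(2) S(1) by (auto simp: poly_p prod_zero_iff)
    qed
    then have "g s0 = (\<lambda>_. 0)"
      by (intro inj[OF gW[OF c(1)], of D]) auto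
    then show False
      using g(2) c(1) by blast
  qed
  have "\<exists>t\<in>E. persistent I (K t)"
  proof (rule ccontr)
    assume "\<not> ?thesis"
    then have "\<forall>t\<in>T (N + D). \<exists>n. t \<notin> T n"
      unfolding T_def persistent_def by blast
    then obtain k where k: "\<And>t. t \<in> T (N + D) \<Longrightarrow> t \<notin> T (k t)"
      by metis
    define n where "n = Max (insert (N + D) (k ` T (N + D)))"
    have "N + D \<le> n" "\<And>t. t \<in> T (N + D) \<Longrightarrow> k t \<le> n"
      unfolding n_def using finite_T by auto
    then show False
      using nonempty[of n] antimono k by blast
  qed
  then show ?thesis
    using that unfolding K_def by blast
qed

text \<open>The variables are treated one after the other, each being made to act as zero whenever this keeps
  the system persistent. A variable for which this failed once keeps failing in smaller systems.\<close>

lemma persistent_coordinates_dichotomy: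
  assumes "inverse_system I W" "persistent I W" "finite J"
  shows "\<exists>V\<subseteq>W. inverse_system I V \<and> persistent I V \<and>
           (\<forall>i\<in>J. (\<forall>f\<in>V. \<forall>m. f (add_mset i m) = 0) \<or>
                  \<not> persistent I (V \<inter> {f. \<forall>m. f (add_mset i m) = 0}))"
  using assms(3)
proof (induction J rule: finite_induct)
  case empty
  then show ?case
    using assms by blast
next
  case (insert j J)
  then obtain V where V: "V \<subseteq> W" "inverse_system I V" "persistent I V"
      "\<And>i. i \<in> J \<Longrightarrow> (\<forall>f\<in>V. \<forall>m. f (add_mset i m) = 0) \<or>
             \<not> persistent I (V \<inter> {f. \<forall>m. f (add_mset i m) = 0})"
    by blast
  define U where "U = V \<inter> {f. \<forall>m. f (add_mset j m) = 0}"
  have "U \<subseteq> V"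
    unfolding U_def by blast
  show ?case
  proof (cases "persistent I U")
    case True
    have "(\<forall>f\<in>U. \<forall>m. f (add_mset i m) = 0) \<or>
        \<not> persistent I (U \<inter> {f. \<forall>m. f (add_mset i m) = 0})" if "i \<in> insert j J" for i
    proof (cases "i = j")
      case False
      then have "i \<in> J"
        using that by simp
      then show ?thesis
        using V(4)[of i] persistent_mono[of I "U \<inter> {f. \<forall>m. f (add_mset i m) = 0}"
            "V \<inter> {f. \<forall>m. f (add_mset i m) = 0}"] \<open>U \<subseteq> V\<close> by blast
    qed (simp add: U_def)
    moreover have "inverse_system I U"
      unfolding U_def by (rule inverse_system_annihilated[OF V(2)])
    moreover have "U \<subseteq> W"
      using V(1) unfolding U_def by blast
    ultimately show ?thesis
      using True by (intro exI[of _ U] conjI ballI)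
  next
    case False
    have "(\<forall>f\<in>V. \<forall>m. f (add_mset i m) = 0) \<or>
        \<not> persistent I (V \<inter> {f. \<forall>m. f (add_mset i m) = 0})" if "i \<in> insert j J" for i
      using that False V(4) unfolding U_def by (cases "i = j") simp_all
    then show ?thesis
      using V(1-3) by (intro exI[of _ V] conjI ballI)
  qed
qed

text \<open>Some variable \<open>x\<close> does not act as zero on the system of the preceding lemma, since otherwise that
  system would vanish in degree \<open>1\<close>. Normalising \<open>\<zeta>\<^sub>x = 1\<close>, the other coordinates are eigenvalues
  relative to \<open>X\<^sub>x\<close>. Once every \<open>X\<^sub>i\<close> acts as \<open>\<zeta>\<^sub>i X\<^sub>x\<close>, a functional is determined by its value at a
  power of \<open>X\<^sub>x\<close> and is a multiple of the evaluation at \<open>\<zeta>\<close>.\<close>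

theorem persistent_contains_evaluation:
  assumes "finite I" "inverse_system I W" "persistent I W"
  obtains \<zeta> x where "\<And>i. \<zeta> i \<in> E" "x \<in> I" "\<zeta> x = 1"
    "\<And>n. \<exists>f\<in>W. \<exists>c. c \<noteq> 0 \<and> (\<forall>m \<in> multisets_of_size I n. f m = c * (\<Prod>i\<in>#m. \<zeta> i))"
proof -
  obtain V where V: "V \<subseteq> W" "inverse_system I V" "persistent I V"
      "\<And>i. i \<in> I \<Longrightarrow> (\<forall>f\<in>V. \<forall>m. f (add_mset i m) = 0) \<or>
             \<not> persistent I (V \<inter> {f. \<forall>m. f (add_mset i m) = 0})"
    using persistent_coordinates_dichotomy[OF assms(2,3,1)] by blast
  obtain x where x: "x \<in> I" "\<not> persistent I (V \<inter> {f. \<forall>m. f (add_mset x m) = 0})"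
  proof -
    obtain f where f: "f \<in> V" "f \<in> homogeneous_functionals I (Suc 0)" "f \<noteq> (\<lambda>_. 0)"
      using V(3) unfolding persistent_def by blast
    obtain i where i: "i \<in> I" "shift i f \<noteq> (\<lambda>_. 0)"
      using nonzero_shift[OF f(2,3)] .
    then have "\<not> (\<forall>m. f (add_mset i m) = 0)"
      by (auto simp: shift_def)
    then show ?thesis
      using that[of i] V(4)[of i] i(1) f(1) by blast
  qed
  have "\<exists>U\<subseteq>V. inverse_system I U \<and> persistent I U \<and>
      (\<exists>\<zeta>. (\<forall>i. \<zeta> i \<in> E) \<and> (\<forall>i\<in>J. \<forall>f\<in>U. \<forall>m. f (add_mset i m) = \<zeta> i * f (add_mset x m)))"
    if "finite J" "J \<subseteq> I" for J
    using that
  proof (induction J rule: finite_induct)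
    case empty
    then show ?case
      using V(1-3) by (intro exI[of _ V] conjI exI[of _ "\<lambda>_. 0"]) simp_all
  next
    case (insert j J)
    have "J \<subseteq> I"
      using insert.prems by simp
    from insert.IH[OF this] obtain U \<zeta>
      where U: "U \<subseteq> V" "inverse_system I U" "persistent I U" "\<forall>i. \<zeta> i \<in> E"
        "\<forall>i\<in>J. \<forall>f\<in>U. \<forall>m. f (add_mset i m) = \<zeta> i * f (add_mset x m)"
      by (elim exE conjE) (rule that)
    have "\<not> persistent I (U \<inter> {f. \<forall>m. f (add_mset x m) = 0})"
      using x(2) U(1) persistent_mono[of I "U \<inter> {f. \<forall>m. f (add_mset x m) = 0}"
          "V \<inter> {f. \<forall>m. f (add_mset x m) = 0}"] by blast
    moreover have "j \<in> I"
      using insert.prems by simp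
    ultimately obtain t where t: "t \<in> E"
        "persistent I (U \<inter> {f. \<forall>m. f (add_mset j m) = t * f (add_mset x m)})"
      using persistent_eigenspace[OF assms(1) U(2,3) x(1), of j thesis] by blast
    define U' where "U' = U \<inter> {f. \<forall>m. f (add_mset j m) = t * f (add_mset x m)}"
    have "inverse_system I U'"
      unfolding U'_def by (rule inverse_system_eigenspace[OF U(2)])
    moreover have "persistent I U'"
      using t unfolding U'_def by simp
    moreover have "\<forall>i\<in>insert j J. \<forall>f\<in>U'. \<forall>m. f (add_mset i m) = (\<zeta>(j := t)) i * f (add_mset x m)"
      using U(5) unfolding U'_def by simp
    moreover have "\<forall>i. (\<zeta>(j := t)) i \<in> E"
      using U(4) t(1) by simp
    moreover have "U' \<subseteq> V"
      using U(1) unfolding U'_def by blast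
    ultimately show ?case
      by (intro exI[of _ U'] conjI exI[of _ "\<zeta>(j := t)"])
  qed
  from this[OF assms(1) subset_refl] obtain U \<zeta>0
    where U: "U \<subseteq> V" "inverse_system I U" "persistent I U" "\<forall>i. \<zeta>0 i \<in> E"
        "\<forall>i\<in>I. \<forall>f\<in>U. \<forall>m. f (add_mset i m) = \<zeta>0 i * f (add_mset x m)"
    by (elim exE conjE) (rule that)
  define \<zeta> where "\<zeta> = \<zeta>0(x := 1)"
  have \<zeta>: "f (add_mset i m) = \<zeta> i * f (add_mset x m)" if "i \<in> I" "f \<in> U" for i f m
    using U(5) that by (simp add: \<zeta>_def)
  have monomial: "f (m + replicate_mset k x) = (\<Prod>i\<in>#m. \<zeta> i) * f (replicate_mset (size m + k) x)"
    if "f \<in> U" "set_mset m \<subseteq> I" for f m k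
    using that(2)
  proof (induction m arbitrary: k)
    case (add i m)
    have "f (add_mset i m + replicate_mset k x) = \<zeta> i * f (m + replicate_mset (Suc k) x)"
      using \<zeta>[of i f "m + replicate_mset k x"] add.prems that(1) by simp
    also have "\<dots> = (\<Prod>i\<in>#add_mset i m. \<zeta> i) * f (replicate_mset (size (add_mset i m) + k) x)"
      using add.IH[of "Suc k"] add.prems by simp
    finally show ?case .
  qed simp
  show ?thesis
  proof (rule that[of \<zeta> x])
    show "\<zeta> i \<in> E" for i
      using U(4) by (simp add: \<zeta>_def)
    show "x \<in> I" "\<zeta> x = 1"
      using x(1) by (simp_all add: \<zeta>_def)
    fix n
    obtain f where f: "f \<in> U" "f \<in> homogeneous_functionals I n" "f \<noteq> (\<lambda>_. 0)"
      using U(3) unfolding persistent_def by blast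
    have eval: "f m = f (replicate_mset n x) * (\<Prod>i\<in>#m. \<zeta> i)" if "m \<in> multisets_of_size I n" for m
      using monomial[OF f(1), of m 0] that by (simp add: multisets_of_size_def)
    have "f (replicate_mset n x) \<noteq> 0"
    proof
      assume zero: "f (replicate_mset n x) = 0"
      have "f m = 0" for m
        using eval[of m] homogeneous_functionals_support[OF f(2), of m] zero
        unfolding multisets_of_size_def by fastforce
      then show False
        using f(3) by blast
    qed
    then show "\<exists>f\<in>W. \<exists>c. c \<noteq> 0 \<and> (\<forall>m \<in> multisets_of_size I n. f m = c * (\<Prod>i\<in>#m. \<zeta> i))"
      using eval f(1) U(1) V(1) by blast
  qed
qed

end

text \<open>The coefficient of the monomial \<open>\<beta>\<close> in the product of the monomial \<open>\<nu>\<close> and the form with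
  coefficients \<open>g\<close>.\<close>

definition multiple_coeff :: "('i multiset \<Rightarrow> 'a::zero) \<Rightarrow> 'i multiset \<Rightarrow> 'i multiset \<Rightarrow> 'a" where
  "multiple_coeff g \<nu> \<beta> = (if \<nu> \<subseteq># \<beta> then g (\<beta> - \<nu>) else 0)"

lemma sum_multiple_coeff:
  fixes g f :: "'i multiset \<Rightarrow> 'a::comm_ring_1"
  assumes "finite I" "set_mset \<nu> \<subseteq> I"
  shows "(\<Sum>\<beta>\<in>multisets_of_size I (size \<nu> + d). f \<beta> * multiple_coeff g \<nu> \<beta>) =
         (\<Sum>\<mu>\<in>multisets_of_size I d. g \<mu> * f (\<nu> + \<mu>))"
proof -
  let ?B = "multisets_of_size I (size \<nu> + d)" and ?M = "multisets_of_size I d"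
  have "(\<Sum>\<mu>\<in>?M. g \<mu> * f (\<nu> + \<mu>)) = (\<Sum>\<beta>\<in>(+) \<nu> ` ?M. f \<beta> * multiple_coeff g \<nu> \<beta>)"
    by (subst sum.reindex) (auto simp: multiple_coeff_def mult.commute)
  also have "\<dots> = (\<Sum>\<beta>\<in>?B. f \<beta> * multiple_coeff g \<nu> \<beta>)"
  proof (intro sum.mono_neutral_left ballI)
    show "finite ?B"
      using assms(1) by (rule finite_multisets_of_size)
    show "(+) \<nu> ` ?M \<subseteq> ?B"
      using assms(2) by (auto simp: multisets_of_size_def)
    fix \<beta>
    assume \<beta>: "\<beta> \<in> ?B - (+) \<nu> ` ?M"
    have "\<not> \<nu> \<subseteq># \<beta>"
    proof
      assume "\<nu> \<subseteq># \<beta>"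
      then obtain \<mu> where "\<beta> = \<nu> + \<mu>"
        by (metis subset_mset.le_iff_add)
      with \<beta> show False
        by (auto simp: multisets_of_size_def)
    qed
    then show "f \<beta> * multiple_coeff g \<nu> \<beta> = 0"
      by (simp add: multiple_coeff_def)
  qed
  finally show ?thesis ..
qed

text \<open>The coefficients of the forms may lie outside \<open>E\<close>: the functionals with values in \<open>E\<close> that
  annihilate a set of vectors over the large field are still an inverse system over \<open>E\<close>, which is
  all that the construction of the point uses.\<close>

theorem (in root_closed_subfield) homogeneous_Nullstellensatz:
  fixes g :: "'j \<Rightarrow> 'i multiset \<Rightarrow> 'a"
  assumes "finite I"
  shows "(\<exists>\<zeta>. (\<forall>i\<in>I. \<zeta> i \<in> E) \<and> (\<exists>i\<in>I. \<zeta> i \<noteq> 0) \<and>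
            (\<forall>j\<in>J. (\<Sum>\<mu>\<in>multisets_of_size I (d j). g j \<mu> * (\<Prod>i\<in>#\<mu>. \<zeta> i)) = 0)) \<longleftrightarrow>
         (\<forall>N. \<exists>f. (\<forall>\<beta>. f \<beta> \<in> E) \<and> (\<exists>\<beta>\<in>multisets_of_size I N. f \<beta> \<noteq> 0) \<and>
            (\<forall>j\<in>J. \<forall>\<nu>. set_mset \<nu> \<subseteq> I \<longrightarrow> size \<nu> + d j = N \<longrightarrow>
               (\<Sum>\<beta>\<in>multisets_of_size I N. f \<beta> * multiple_coeff (g j) \<nu> \<beta>) = 0))"
    (is "?L \<longleftrightarrow> ?R")
proof
  assume ?L
  then obtain \<zeta> i0 where \<zeta>: "\<And>i. i \<in> I \<Longrightarrow> \<zeta> i \<in> E" "i0 \<in> I" "\<zeta> i0 \<noteq> 0"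
      "\<And>j. j \<in> J \<Longrightarrow> (\<Sum>\<mu>\<in>multisets_of_size I (d j). g j \<mu> * (\<Prod>i\<in>#\<mu>. \<zeta> i)) = 0"
    by blast
  define f where "f \<beta> = (if set_mset \<beta> \<subseteq> I then \<Prod>i\<in>#\<beta>. \<zeta> i else 0)" for \<beta>
  show ?R
  proof (intro allI exI[of _ f] conjI ballI impI)
    fix N
    show "f \<beta> \<in> E" for \<beta>
    proof (induction \<beta>)
      case (add i \<beta>)
      then show ?case
        using \<zeta>(1) by (auto simp: f_def)
    qed (simp add: f_def)
    show "\<exists>\<beta>\<in>multisets_of_size I N. f \<beta> \<noteq> 0"
      using \<zeta>(2,3) by (intro bexI[of _ "replicate_mset N i0"])
        (auto simp: f_def multisets_of_size_def split: if_splits)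
    fix j \<nu>
    assume j: "j \<in> J" and \<nu>: "set_mset \<nu> \<subseteq> I" "size \<nu> + d j = N"
    have "(\<Sum>\<beta>\<in>multisets_of_size I N. f \<beta> * multiple_coeff (g j) \<nu> \<beta>) =
        (\<Sum>\<mu>\<in>multisets_of_size I (d j). g j \<mu> * f (\<nu> + \<mu>))"
      using sum_multiple_coeff[OF assms \<nu>(1)] \<nu>(2) by metis
    also have "\<dots> = (\<Prod>i\<in>#\<nu>. \<zeta> i) * (\<Sum>\<mu>\<in>multisets_of_size I (d j). g j \<mu> * (\<Prod>i\<in>#\<mu>. \<zeta> i))"
      unfolding sum_distrib_left using \<nu>(1)
      by (intro sum.cong) (auto simp: f_def multisets_of_size_def ac_simps)
    also have "\<dots> = 0"
      using \<zeta>(4)[OF j] by simp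
    finally show "(\<Sum>\<beta>\<in>multisets_of_size I N. f \<beta> * multiple_coeff (g j) \<nu> \<beta>) = 0" .
  qed
next
  assume R: ?R
  \<comment> \<open>The annihilator of the ideal generated by the forms, without restriction to a degree.\<close>
  define W where "W = {f. \<forall>j\<in>J. \<forall>\<nu>. set_mset \<nu> \<subseteq> I \<longrightarrow>
      (\<Sum>\<mu>\<in>multisets_of_size I (d j). g j \<mu> * f (\<nu> + \<mu>)) = 0}"
  have W: "(\<Sum>\<mu>\<in>multisets_of_size I (d j). g j \<mu> * f (\<nu> + \<mu>)) = 0"
    if "f \<in> W" "j \<in> J" "set_mset \<nu> \<subseteq> I" for f j \<nu>
    using that unfolding W_def by simp
  have "inverse_system I W"
    unfolding inverse_system_def
  proof (intro conjI ballI)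
    fix a b f h
    assume "f \<in> W" "h \<in> W"
    have "(\<Sum>\<mu>\<in>multisets_of_size I (d j). g j \<mu> * (a * f (\<nu> + \<mu>) + b * h (\<nu> + \<mu>))) = 0"
      if "j \<in> J" "set_mset \<nu> \<subseteq> I" for j \<nu>
    proof -
      have "(\<Sum>\<mu>\<in>multisets_of_size I (d j). g j \<mu> * (a * f (\<nu> + \<mu>) + b * h (\<nu> + \<mu>))) =
          a * (\<Sum>\<mu>\<in>multisets_of_size I (d j). g j \<mu> * f (\<nu> + \<mu>)) +
          b * (\<Sum>\<mu>\<in>multisets_of_size I (d j). g j \<mu> * h (\<nu> + \<mu>))"
        by (simp add: sum_distrib_left algebra_simps sum.distrib)
      then show ?thesis
        using W[OF \<open>f \<in> W\<close> that] W[OF \<open>h \<in> W\<close> that] by simp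
    qed
    then show "(\<lambda>m. a * f m + b * h m) \<in> W"
      unfolding W_def by simp
  next
    fix i f
    assume "i \<in> I" "f \<in> W"
    then have "(\<Sum>\<mu>\<in>multisets_of_size I (d j). g j \<mu> * shift i f (\<nu> + \<mu>)) = 0"
      if "j \<in> J" "set_mset \<nu> \<subseteq> I" for j \<nu>
      using W[OF \<open>f \<in> W\<close> that(1), of "add_mset i \<nu>"] that(2) by (simp add: shift_def)
    then show "shift i f \<in> W"
      unfolding W_def by simp
  qed
  moreover have "persistent I W"
    unfolding persistent_def
  proof
    fix N
    from R obtain f where f: "\<forall>\<beta>. f \<beta> \<in> E" "\<exists>\<beta>\<in>multisets_of_size I N. f \<beta> \<noteq> 0"
        "\<forall>j\<in>J. \<forall>\<nu>. set_mset \<nu> \<subseteq> I \<longrightarrow> size \<nu> + d j = N \<longrightarrow>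
           (\<Sum>\<beta>\<in>multisets_of_size I N. f \<beta> * multiple_coeff (g j) \<nu> \<beta>) = 0"
      by meson
    \<comment> \<open>Outside degree \<open>N\<close> the given functional is unconstrained, so it is replaced by \<open>0\<close> there.\<close>
    define f' where "f' \<beta> = (if \<beta> \<in> multisets_of_size I N then f \<beta> else 0)" for \<beta>
    have "(\<Sum>\<mu>\<in>multisets_of_size I (d j). g j \<mu> * f' (\<nu> + \<mu>)) = 0"
      if "j \<in> J" "set_mset \<nu> \<subseteq> I" for j \<nu>
    proof (cases "size \<nu> + d j = N")
      case True
      have "(\<Sum>\<mu>\<in>multisets_of_size I (d j). g j \<mu> * f' (\<nu> + \<mu>)) =
          (\<Sum>\<beta>\<in>multisets_of_size I N. f' \<beta> * multiple_coeff (g j) \<nu> \<beta>)"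
        using sum_multiple_coeff[OF assms that(2)] True by metis
      also have "\<dots> = (\<Sum>\<beta>\<in>multisets_of_size I N. f \<beta> * multiple_coeff (g j) \<nu> \<beta>)"
        by (intro sum.cong) (auto simp: f'_def)
      finally show ?thesis
        using f(3) that True by simp
    next
      case False
      then show ?thesis
        by (intro sum.neutral) (auto simp: f'_def multisets_of_size_def)
    qed
    then have "f' \<in> W"
      unfolding W_def by simp
    moreover have "f' \<in> homogeneous_functionals I N"
      using f(1) by (intro homogeneous_functionalsI) (auto simp: f'_def multisets_of_size_def split: if_splits)
    moreover have "f' \<noteq> (\<lambda>_. 0)"
      using f(2) by (auto simp: f'_def fun_eq_iff)
    ultimately show "\<exists>f \<in> W \<inter> homogeneous_functionals I N. f \<noteq> (\<lambda>_. 0)"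
      by blast
  qed
  ultimately obtain \<zeta> x where \<zeta>: "\<And>i. \<zeta> i \<in> E" "x \<in> I" "\<zeta> x = 1"
      and eval: "\<And>n. \<exists>f\<in>W. \<exists>c. c \<noteq> 0 \<and> (\<forall>m \<in> multisets_of_size I n. f m = c * (\<Prod>i\<in>#m. \<zeta> i))"
    using persistent_contains_evaluation[OF assms] by metis
  show ?L
  proof (intro exI[of _ \<zeta>] conjI ballI)
    show "\<zeta> i \<in> E" for i
      by (rule \<zeta>)
    show "\<exists>i\<in>I. \<zeta> i \<noteq> 0"
      using \<zeta>(2,3) by (intro bexI[of _ x]) auto
    fix j
    assume j: "j \<in> J"
    obtain f c where f: "f \<in> W" "c \<noteq> 0" "\<forall>m \<in> multisets_of_size I (d j). f m = c * (\<Prod>i\<in>#m. \<zeta> i)"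
      using eval by blast
    have "0 = (\<Sum>\<mu>\<in>multisets_of_size I (d j). g j \<mu> * f \<mu>)"
      using W[OF f(1) j, of "{#}"] by simp
    also have "\<dots> = c * (\<Sum>\<mu>\<in>multisets_of_size I (d j). g j \<mu> * (\<Prod>i\<in>#\<mu>. \<zeta> i))"
      unfolding sum_distrib_left using f(3) by (intro sum.cong) auto
    finally show "(\<Sum>\<mu>\<in>multisets_of_size I (d j). g j \<mu> * (\<Prod>i\<in>#\<mu>. \<zeta> i)) = 0"
      using f(2) by simp
  qed
qed

section \<open>Constants of a derivation\<close>

lemma derivation_add: "derivation \<delta> \<Longrightarrow> \<delta> (x + y) = \<delta> x + \<delta> y"
  and derivation_mult: "derivation \<delta> \<Longrightarrow> \<delta> (x * y) = \<delta> x * y + x * \<delta> y"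
  unfolding derivation_def by blast+

lemma derivation_zero:
  assumes "derivation \<delta>"
  shows "\<delta> 0 = 0"
  using derivation_add[OF assms, of 0 0] by (metis add.right_neutral add_left_cancel)

lemma derivation_one:
  assumes "derivation \<delta>"
  shows "\<delta> 1 = 0"
  using derivation_mult[OF assms, of 1 1] by (metis add.right_neutral add_left_cancel mult_1 mult.right_neutral)

lemma derivation_uminus:
  assumes "derivation \<delta>"
  shows "\<delta> (- x) = - \<delta> x"
  using derivation_add[OF assms, of x "- x"] derivation_zero[OF assms]
  by (metis add.right_inverse add_eq_0_iff)

lemma derivation_sum: "derivation \<delta> \<Longrightarrow> \<delta> (sum f A) = (\<Sum>x\<in>A. \<delta> (f x))"
  by (induction A rule: infinite_finite_induct) (simp_all add: derivation_zero derivation_add)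

lemma derivation_power:
  assumes "derivation \<delta>"
  shows "\<delta> (x ^ n) = of_nat n * x ^ (n - 1) * \<delta> x"
proof (induction n)
  case (Suc n)
  have "\<delta> (x ^ Suc n) = \<delta> x * x ^ n + x * \<delta> (x ^ n)"
    by (simp add: derivation_mult[OF assms])
  also have "\<dots> = of_nat (Suc n) * x ^ (Suc n - 1) * \<delta> x"
    unfolding Suc.IH by (cases n) (simp_all add: algebra_simps)
  finally show ?case .
qed (simp add: derivation_one[OF assms])

text \<open>In characteristic \<open>p\<close> every element of an algebraically closed field is a \<open>p\<close>-th power, and \<open>p\<close>-th
  powers have derivative zero.\<close>

lemma of_nat_neq_zero_if_derivation:
  fixes \<delta> :: "'a::alg_closed_field \<Rightarrow> 'a"
  assumes "derivation \<delta>" "\<delta> x \<noteq> 0" "n > 0"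
  shows "(of_nat n :: 'a) \<noteq> 0"
proof
  assume "(of_nat n :: 'a) = 0"
  obtain y where "y ^ n = x"
    using nth_root_exists[OF \<open>n > 0\<close>] by blast
  then show False
    using derivation_power[OF assms(1), of y n] \<open>of_nat n = 0\<close> assms(2) by simp
qed

lemma derivation_poly_constant_coeffs:
  assumes "derivation \<delta>" "\<And>k. \<delta> (coeff p k) = 0"
  shows "\<delta> (poly p t) = poly (pderiv p) t * \<delta> t"
  using assms(2)
proof (induction p)
  case 0
  then show ?case
    by (simp add: derivation_zero[OF assms(1)])
next
  case (pCons c p)
  have "\<delta> c = 0" "\<And>k. \<delta> (coeff p k) = 0"
    using pCons.prems[of 0] pCons.prems[of "Suc k" for k] by simp_all
  then have "\<delta> (poly (pCons c p) t) = \<delta> t * poly p t + t * (poly (pderiv p) t * \<delta> t)"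
    using pCons.IH by (simp add: derivation_add[OF assms(1)] derivation_mult[OF assms(1)])
  then show ?case
    by (simp add: pderiv_pCons algebra_simps)
qed

text \<open>Differentiating \<open>p(t) = 0\<close> for \<open>p\<close> with constant coefficients gives \<open>p'(t) \<delta>(t) = 0\<close>. If \<open>p'(t) = 0\<close>,
  then \<open>p'\<close> is a polynomial of smaller degree with root \<open>t\<close>, nonzero because the characteristic is
  zero.\<close>

lemma constants_root_closed_subfield:
  fixes \<delta> :: "'a::alg_closed_field \<Rightarrow> 'a"
  assumes \<delta>: "derivation \<delta>" and "\<exists>x. \<delta> x \<noteq> 0"
  shows "root_closed_subfield (constants \<delta>)"
proof -
  note derivation_rules = derivation_zero[OF \<delta>] derivation_one[OF \<delta>] derivation_add[OF \<delta>]
    derivation_mult[OF \<delta>] derivation_uminus[OF \<delta>]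
  have char: "(of_nat n :: 'a) \<noteq> 0" if "n > 0" for n
    using of_nat_neq_zero_if_derivation[OF \<delta>] assms(2) that by blast
  have inverse: "\<delta> (inverse x) = 0" if "\<delta> x = 0" for x
  proof (cases "x = 0")
    case False
    have "\<delta> (x * inverse x) = x * \<delta> (inverse x)"
      by (simp only: derivation_mult[OF \<delta>] that mult_zero_left add_0_left)
    then show ?thesis
      using False by (simp add: derivation_one[OF \<delta>])
  qed (simp add: derivation_zero[OF \<delta>])
  have "\<delta> (of_nat n) = 0" for n
    by (induction n) (simp_all add: derivation_rules)
  then have pderiv: "\<delta> (coeff (pderiv p) k) = 0" if "\<And>k. \<delta> (coeff p k) = 0" for p k
    using that derivation_mult[OF \<delta>, of "of_nat (Suc k)" "coeff p (Suc k)"]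
    by (metis coeff_pderiv add.right_neutral mult_zero_left mult_zero_right)
  have root: "\<delta> t = 0" if "p \<noteq> 0" "\<And>k. \<delta> (coeff p k) = 0" "poly p t = 0" for p t
    using that
  proof (induction "degree p" arbitrary: p rule: less_induct)
    case less
    have "degree p > 0"
    proof (rule ccontr)
      assume "\<not> degree p > 0"
      then obtain c where "p = [:c:]"
        by (auto elim: degree_eq_zeroE)
      then show False
        using less.prems(1,3) by simp
    qed
    have "poly (pderiv p) t * \<delta> t = 0"
      using derivation_poly_constant_coeffs[OF \<delta> less.prems(2), of t] less.prems(3)
      by (simp add: derivation_zero[OF \<delta>])
    moreover have "poly (pderiv p) t \<noteq> 0 \<or> \<delta> t = 0"
    proof (cases "poly (pderiv p) t = 0")
      case True
      have "coeff (pderiv p) (degree p - 1) = of_nat (degree p) * lead_coeff p"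
        using \<open>degree p > 0\<close> by (simp add: coeff_pderiv)
      then have "pderiv p \<noteq> 0"
        using char[OF \<open>degree p > 0\<close>] less.prems(1) by auto
      moreover have "degree (pderiv p) \<le> degree p - 1"
        by (intro degree_le) (auto simp: coeff_pderiv coeff_eq_0)
      then have "degree (pderiv p) < degree p"
        using \<open>degree p > 0\<close> by simp
      ultimately show ?thesis
        using less.hyps[of "pderiv p"] pderiv[OF less.prems(2)] True by blast
    qed simp
    ultimately show ?case
      by auto
  qed
  show ?thesis
    by unfold_locales (simp_all add: constants_def derivation_rules inverse root)
qed

text \<open>The equations on the right define a subspace stable under \<open>\<delta>\<close>, by the product rule. A \<open>\<delta>\<close>-stable
  subspace contains a constant vector: normalise one entry of a nonzero element of minimal support
  to \<open>1\<close>; its derivative has smaller support, hence vanishes.\<close>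

theorem constant_annihilator_iff:
  fixes \<delta> :: "'a::field \<Rightarrow> 'a"
  assumes \<delta>: "derivation \<delta>" and "finite B"
  shows "(\<exists>f. (\<forall>\<beta>. f \<beta> \<in> constants \<delta>) \<and> (\<exists>\<beta>\<in>B. f \<beta> \<noteq> 0) \<and> (\<forall>v\<in>V. (\<Sum>\<beta>\<in>B. f \<beta> * v \<beta>) = 0)) \<longleftrightarrow>
         (\<exists>f. (\<exists>\<beta>\<in>B. f \<beta> \<noteq> 0) \<and> (\<forall>v\<in>V. \<forall>k. (\<Sum>\<beta>\<in>B. f \<beta> * (\<delta> ^^ k) (v \<beta>)) = 0))"
    (is "?L \<longleftrightarrow> ?R")
proof
  assume ?L
  then obtain f where f: "\<And>\<beta>. f \<beta> \<in> constants \<delta>" "\<exists>\<beta>\<in>B. f \<beta> \<noteq> 0"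
      "\<And>v. v \<in> V \<Longrightarrow> (\<Sum>\<beta>\<in>B. f \<beta> * v \<beta>) = 0"
    by blast
  have "(\<Sum>\<beta>\<in>B. f \<beta> * (\<delta> ^^ k) (v \<beta>)) = 0" if "v \<in> V" for v k
  proof (induction k)
    case (Suc k)
    have "0 = \<delta> (\<Sum>\<beta>\<in>B. f \<beta> * (\<delta> ^^ k) (v \<beta>))"
      by (simp add: Suc derivation_zero[OF \<delta>])
    also have "\<dots> = (\<Sum>\<beta>\<in>B. f \<beta> * (\<delta> ^^ Suc k) (v \<beta>))"
      using f(1) by (simp add: derivation_sum[OF \<delta>] derivation_mult[OF \<delta>] constants_def)
    finally show ?case ..
  qed (simp add: f(3) that)
  then show ?R
    using f(2) by blast
next
  assume ?R
  define A where "A f \<longleftrightarrow> (\<exists>\<beta>\<in>B. f \<beta> \<noteq> 0) \<and> (\<forall>v\<in>V. \<forall>k. (\<Sum>\<beta>\<in>B. f \<beta> * (\<delta> ^^ k) (v \<beta>)) = 0)" for f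
  define supp where "supp f = {\<beta>\<in>B. f \<beta> \<noteq> 0}" for f :: "'b \<Rightarrow> 'a"
  obtain f where f: "A f" and least: "\<And>h. A h \<Longrightarrow> card (supp f) \<le> card (supp h)"
    using ex_has_least_nat[of A _ "\<lambda>f. card (supp f)"] \<open>?R\<close> unfolding A_def by blast
  obtain \<beta>0 where \<beta>0: "\<beta>0 \<in> B" "f \<beta>0 \<noteq> 0"
    using f unfolding A_def by blast
  define h where "h \<beta> = f \<beta> / f \<beta>0" for \<beta>
  have h_sum: "(\<Sum>\<beta>\<in>B. h \<beta> * (\<delta> ^^ k) (v \<beta>)) = 0" if "v \<in> V" for v k
  proof -
    have "(\<Sum>\<beta>\<in>B. h \<beta> * (\<delta> ^^ k) (v \<beta>)) = (\<Sum>\<beta>\<in>B. f \<beta> * (\<delta> ^^ k) (v \<beta>)) / f \<beta>0"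
      by (simp add: h_def sum_divide_distrib)
    then show ?thesis
      using f that unfolding A_def by simp
  qed
  have "\<delta> (h \<beta>) = 0" if "\<beta> \<in> B" for \<beta>
  proof (rule ccontr)
    assume "\<delta> (h \<beta>) \<noteq> 0"
    have "(\<Sum>\<beta>\<in>B. \<delta> (h \<beta>) * (\<delta> ^^ k) (v \<beta>)) = 0" if "v \<in> V" for v k
    proof -
      have "0 = \<delta> (\<Sum>\<beta>\<in>B. h \<beta> * (\<delta> ^^ k) (v \<beta>))"
        using h_sum[OF that] by (simp add: derivation_zero[OF \<delta>])
      also have "\<dots> = (\<Sum>\<beta>\<in>B. \<delta> (h \<beta>) * (\<delta> ^^ k) (v \<beta>)) + (\<Sum>\<beta>\<in>B. h \<beta> * (\<delta> ^^ Suc k) (v \<beta>))"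
        by (simp add: derivation_sum[OF \<delta>] derivation_mult[OF \<delta>] sum.distrib)
      finally show ?thesis
        using h_sum[OF that, of "Suc k"] by simp
    qed
    then have "A (\<lambda>\<beta>. \<delta> (h \<beta>))"
      using \<open>\<delta> (h \<beta>) \<noteq> 0\<close> \<open>\<beta> \<in> B\<close> unfolding A_def by blast
    then have "card (supp f) \<le> card (supp (\<lambda>\<beta>. \<delta> (h \<beta>)))"
      by (rule least)
    moreover have "supp (\<lambda>\<beta>. \<delta> (h \<beta>)) \<subset> supp f"
    proof -
      have "\<delta> (h \<beta>) = 0" if "f \<beta> = 0" for \<beta>
        using that by (simp add: h_def derivation_zero[OF \<delta>])
      moreover have "\<delta> (h \<beta>0) = 0"
        using \<beta>0 by (simp add: h_def derivation_one[OF \<delta>])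
      ultimately show ?thesis
        using \<beta>0 unfolding supp_def by blast
    qed
    then have "card (supp (\<lambda>\<beta>. \<delta> (h \<beta>))) < card (supp f)"
      using \<open>finite B\<close> by (intro psubset_card_mono) (auto simp: supp_def)
    ultimately show False
      by simp
  qed
  then have "\<forall>\<beta>. (if \<beta> \<in> B then h \<beta> else 0) \<in> constants \<delta>"
    by (simp add: constants_def derivation_zero[OF \<delta>])
  moreover have "\<exists>\<beta>\<in>B. (if \<beta> \<in> B then h \<beta> else 0) \<noteq> 0"
    using \<beta>0 by (intro bexI[of _ \<beta>0]) (auto simp: h_def)
  moreover have "\<forall>v\<in>V. (\<Sum>\<beta>\<in>B. (if \<beta> \<in> B then h \<beta> else 0) * v \<beta>) = 0"
    using h_sum[of _ 0] by simp
  ultimately show ?L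
    by (intro exI[of _ "\<lambda>\<beta>. if \<beta> \<in> B then h \<beta> else 0"] conjI)
qed

section \<open>Elimination of linear unknowns\<close>

text \<open>Closed sets for an arbitrary family \<open>R\<close> of functions; infinitely many equations are permitted.\<close>

definition zero_locus :: "('p \<Rightarrow> 'a::zero) set \<Rightarrow> 'p set \<Rightarrow> bool" where
  "zero_locus R S \<longleftrightarrow> (\<exists>F\<subseteq>R. S = {a. \<forall>f\<in>F. f a = 0})"

lemma zero_locusI: "F \<subseteq> R \<Longrightarrow> (\<And>a. a \<in> S \<longleftrightarrow> (\<forall>f\<in>F. f a = 0)) \<Longrightarrow> zero_locus R S"
  unfolding zero_locus_def by (intro exI[of _ F] conjI set_eqI) simp_all

lemma zero_locus_single: "f \<in> R \<Longrightarrow> zero_locus R {a. f a = 0}"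
  by (rule zero_locusI[of "{f}"]) simp_all

lemma zero_locus_INT:
  assumes "\<And>i. i \<in> I \<Longrightarrow> zero_locus R (S i)"
  shows "zero_locus R (\<Inter>i\<in>I. S i)"
proof -
  have "\<forall>i\<in>I. \<exists>F. F \<subseteq> R \<and> S i = {a. \<forall>f\<in>F. f a = 0}"
    using assms unfolding zero_locus_def by simp
  from bchoice[OF this] obtain F
    where F: "\<forall>i\<in>I. F i \<subseteq> R \<and> S i = {a. \<forall>f\<in>F i. f a = 0}" ..
  show ?thesis
  proof (rule zero_locusI)
    show "(\<Union>i\<in>I. F i) \<subseteq> R"
      using F by (intro UN_least) simp
    show "a \<in> (\<Inter>i\<in>I. S i) \<longleftrightarrow> (\<forall>f\<in>\<Union>i\<in>I. F i. f a = 0)" for a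
      using F by simp
  qed
qed

lemma zero_locus_Un:
  fixes R :: "('p \<Rightarrow> 'a::idom) set"
  assumes mult: "\<And>f g. f \<in> R \<Longrightarrow> g \<in> R \<Longrightarrow> (\<lambda>a. f a * g a) \<in> R"
    and S: "zero_locus R S" and T: "zero_locus R T"
  shows "zero_locus R (S \<union> T)"
proof -
  obtain F where F: "F \<subseteq> R" "S = {a. \<forall>f\<in>F. f a = 0}"
    using S unfolding zero_locus_def by (elim exE conjE) (rule that)
  obtain G where G: "G \<subseteq> R" "T = {a. \<forall>g\<in>G. g a = 0}"
    using T unfolding zero_locus_def by (elim exE conjE) (rule that)
  show ?thesis
  proof (rule zero_locusI)
    show "(\<lambda>(f, g) a. f a * g a) ` (F \<times> G) \<subseteq> R"
      using mult F(1) G(1) by auto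
    fix a
    have "(\<forall>h\<in>(\<lambda>(f, g) a. f a * g a) ` (F \<times> G). h a = 0) \<longleftrightarrow> (\<forall>f\<in>F. \<forall>g\<in>G. f a = 0 \<or> g a = 0)"
      by simp
    then show "a \<in> S \<union> T \<longleftrightarrow> (\<forall>h\<in>(\<lambda>(f, g) a. f a * g a) ` (F \<times> G). h a = 0)"
      unfolding F(2) G(2) by blast
  qed
qed

text \<open>Gaussian elimination that is uniform in the parameter \<open>a\<close>. An equation \<open>u\<close> with \<open>u\<^sub>b(a) \<noteq> 0\<close> can be
  solved for the unknown \<open>c\<^sub>b\<close>; substitution leaves the equations with coefficients
  \<open>v\<^sub>\<beta> u\<^sub>b - v\<^sub>b u\<^sub>\<beta>\<close> in fewer unknowns, closed by induction. If all \<open>u\<^sub>b(a)\<close> vanish, the unit vector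
  at \<open>b\<close> is a solution. Hence the set is the intersection over all \<open>u\<close> of \<open>{u\<^sub>b = 0} \<union> C\<^sub>u\<close>, where
  \<open>C\<^sub>u\<close> belongs to the substituted system; dividing is avoided and no pivot has to be chosen.\<close>

theorem zero_locus_linear_dependence:
  fixes R :: "('p \<Rightarrow> 'a::field) set"
  assumes one: "(\<lambda>_. 1) \<in> R"
    and diff: "\<And>f g. f \<in> R \<Longrightarrow> g \<in> R \<Longrightarrow> (\<lambda>a. f a - g a) \<in> R"
    and mult: "\<And>f g. f \<in> R \<Longrightarrow> g \<in> R \<Longrightarrow> (\<lambda>a. f a * g a) \<in> R"
    and "finite B" and "\<And>v \<beta>. v \<in> V \<Longrightarrow> \<beta> \<in> B \<Longrightarrow> v \<beta> \<in> R"
  shows "zero_locus R {a. \<exists>c. (\<exists>\<beta>\<in>B. c \<beta> \<noteq> 0) \<and> (\<forall>v\<in>V. (\<Sum>\<beta>\<in>B. c \<beta> * v \<beta> a) = 0)}"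
  using assms(4,5)
proof (induction B arbitrary: V rule: finite_induct)
  case empty
  then show ?case
    using zero_locus_single[OF one] by simp
next
  case (insert b B)
  define V' where "V' u = (\<lambda>v \<beta> a. v \<beta> a * u b a - v b a * u \<beta> a) ` V" for u
  define C where "C u = {a. \<exists>c. (\<exists>\<beta>\<in>B. c \<beta> \<noteq> 0) \<and> (\<forall>v\<in>V' u. (\<Sum>\<beta>\<in>B. c \<beta> * v \<beta> a) = 0)}" for u
  define S where "S u = {a. u b a = 0} \<union> C u" for u
  have closed: "zero_locus R (\<Inter>u\<in>V. S u)"
  proof (rule zero_locus_INT)
    fix u
    assume u: "u \<in> V"
    have "zero_locus R (C u)"
      unfolding C_def
    proof (rule insert.IH)
      show "v \<beta> \<in> R" if "v \<in> V' u" "\<beta> \<in> B" for v \<beta>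
        using that u insert.prems unfolding V'_def by (auto intro!: diff mult)
    qed
    then show "zero_locus R (S u)"
      unfolding S_def using u insert.prems by (intro zero_locus_Un mult zero_locus_single) auto
  qed
  have "{a. \<exists>c. (\<exists>\<beta>\<in>insert b B. c \<beta> \<noteq> 0) \<and> (\<forall>v\<in>V. (\<Sum>\<beta>\<in>insert b B. c \<beta> * v \<beta> a) = 0)} = (\<Inter>u\<in>V. S u)"
    (is "?D = _")
  proof (intro equalityI subsetI)
    fix a
    assume "a \<in> ?D"
    then obtain c where c: "\<exists>\<beta>\<in>insert b B. c \<beta> \<noteq> 0"
        "\<And>v. v \<in> V \<Longrightarrow> c b * v b a + (\<Sum>\<beta>\<in>B. c \<beta> * v \<beta> a) = 0"
      using insert.hyps by auto
    have "a \<in> S u" if u: "u \<in> V" for u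
    proof (cases "u b a = 0")
      case False
      have "\<exists>\<beta>\<in>B. c \<beta> \<noteq> 0"
      proof (rule ccontr)
        assume zero: "\<not> ?thesis"
        then have "(\<Sum>\<beta>\<in>B. c \<beta> * u \<beta> a) = 0"
          by (intro sum.neutral) auto
        then show False
          using c(2)[OF u] c(1) zero False by auto
      qed
      moreover have "(\<Sum>\<beta>\<in>B. c \<beta> * (v \<beta> a * u b a - v b a * u \<beta> a)) = 0" if v: "v \<in> V" for v
      proof -
        have "(\<Sum>\<beta>\<in>B. c \<beta> * (v \<beta> a * u b a - v b a * u \<beta> a)) =
            u b a * (\<Sum>\<beta>\<in>B. c \<beta> * v \<beta> a) - v b a * (\<Sum>\<beta>\<in>B. c \<beta> * u \<beta> a)"
          by (simp add: sum_distrib_left sum_subtractf algebra_simps)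
        also have "\<dots> = u b a * (- (c b * v b a)) - v b a * (- (c b * u b a))"
          using c(2)[OF u] c(2)[OF v] by (simp add: add_eq_0_iff)
        finally show ?thesis
          by (simp add: algebra_simps)
      qed
      ultimately have "a \<in> C u"
        unfolding C_def V'_def by auto
      then show ?thesis
        by (simp add: S_def)
    qed (simp add: S_def)
    then show "a \<in> (\<Inter>u\<in>V. S u)"
      by blast
  next
    fix a
    assume a: "a \<in> (\<Inter>u\<in>V. S u)"
    show "a \<in> ?D"
    proof (cases "\<exists>u\<in>V. u b a \<noteq> 0")
      case True
      then obtain u where u: "u \<in> V" "u b a \<noteq> 0"
        by blast
      then have "a \<in> C u"
        using a unfolding S_def by blast
      then obtain c where c: "\<exists>\<beta>\<in>B. c \<beta> \<noteq> 0"
          "\<And>v. v \<in> V \<Longrightarrow> (\<Sum>\<beta>\<in>B. c \<beta> * (v \<beta> a * u b a - v b a * u \<beta> a)) = 0"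
        unfolding C_def V'_def by auto
      define d where "d = - (\<Sum>\<beta>\<in>B. c \<beta> * u \<beta> a) / u b a"
      have "d * v b a + (\<Sum>\<beta>\<in>B. c \<beta> * v \<beta> a) = 0" if v: "v \<in> V" for v
      proof -
        have "u b a * (\<Sum>\<beta>\<in>B. c \<beta> * v \<beta> a) - v b a * (\<Sum>\<beta>\<in>B. c \<beta> * u \<beta> a) = 0"
          using c(2)[OF v] by (simp add: sum_distrib_left sum_subtractf algebra_simps)
        then show ?thesis
          using u(2) by (simp add: d_def field_simps)
      qed
      moreover have "(\<Sum>\<beta>\<in>insert b B. (c(b := d)) \<beta> * v \<beta> a) = d * v b a + (\<Sum>\<beta>\<in>B. c \<beta> * v \<beta> a)" for v
      proof -
        have "(\<Sum>\<beta>\<in>B. (c(b := d)) \<beta> * v \<beta> a) = (\<Sum>\<beta>\<in>B. c \<beta> * v \<beta> a)"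
          using insert.hyps by (intro sum.cong) auto
        then show ?thesis
          using insert.hyps by simp
      qed
      moreover have "\<exists>\<beta>\<in>insert b B. (c(b := d)) \<beta> \<noteq> 0"
        using c(1) insert.hyps by auto
      ultimately show ?thesis
        by (auto intro!: exI[of _ "c(b := d)"] simp del: fun_upd_apply)
    next
      case False
      have "(\<Sum>\<beta>\<in>insert b B. (if \<beta> = b then 1 else 0) * v \<beta> a) = 0" if "v \<in> V" for v
        using False that by (intro sum.neutral) auto
      then show ?thesis
        by (intro CollectI exI[of _ "\<lambda>\<beta>. if \<beta> = b then 1 else 0"] conjI bexI[of _ b]) auto
    qed
  qed
  then show ?case
    using closed by simp
qed

section \<open>Differential polynomial functions\<close>

definition monomial_val :: "('v \<Rightarrow> 'a::comm_semiring_1) \<Rightarrow> ('v \<Rightarrow>\<^sub>0 nat) \<Rightarrow> 'a" where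
  "monomial_val e m = (\<Prod>v\<in>Poly_Mapping.keys m. e v ^ Poly_Mapping.lookup m v)"

text \<open>Evaluation with coefficients mapped by \<open>h\<close>, so as to cover both integer polynomials evaluated in
  \<open>K\<close> and differential polynomials over \<open>K\<close>.\<close>

definition mpoly_val ::
    "('b::zero \<Rightarrow> 'a::comm_semiring_1) \<Rightarrow> ('v \<Rightarrow> 'a) \<Rightarrow> (('v \<Rightarrow>\<^sub>0 nat) \<Rightarrow>\<^sub>0 'b) \<Rightarrow> 'a" where
  "mpoly_val h e p =
     (\<Sum>m\<in>Poly_Mapping.keys p. h (Poly_Mapping.lookup p m) * monomial_val e m)"

lemma monomial_val_add: "monomial_val e (m + m') = monomial_val e m * monomial_val e m'"
proof -
  let ?K = "Poly_Mapping.keys m \<union> Poly_Mapping.keys m'"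
  have superset: "monomial_val e q = (\<Prod>v\<in>?K. e v ^ Poly_Mapping.lookup q v)"
    if "Poly_Mapping.keys q \<subseteq> ?K" for q
    unfolding monomial_val_def using that
    by (intro prod.mono_neutral_left) (auto simp: in_keys_iff)
  have "monomial_val e (m + m') = (\<Prod>v\<in>?K. e v ^ Poly_Mapping.lookup (m + m') v)"
    by (rule superset[OF Poly_Mapping.keys_add])
  also have "\<dots> = monomial_val e m * monomial_val e m'"
    by (simp add: superset lookup_add power_add prod.distrib)
  finally show ?thesis .
qed

lemma mpoly_val_single:
  assumes "h 0 = 0"
  shows "mpoly_val h e (Poly_Mapping.single m c) = h c * monomial_val e m"
  using assms by (simp add: mpoly_val_def)

lemma mpoly_val_add:
  assumes "h 0 = 0" "\<And>x y. h (x + y) = h x + h y"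
  shows "mpoly_val h e (p + q) = mpoly_val h e p + mpoly_val h e q"
  unfolding mpoly_val_def
  by (rule setsum_keys_plus_distrib[where f = "\<lambda>m c. h c * monomial_val e m"])
    (simp_all add: assms algebra_simps)

lemma poly_mapping_single_add_induct [case_names zero single_add]:
  assumes "P 0" "\<And>m c p. P p \<Longrightarrow> P (Poly_Mapping.single m c + p)"
  shows "P (p :: 'k \<Rightarrow>\<^sub>0 'b::comm_monoid_add)"
proof (induction p rule: Poly_Mapping.update_induct)
  case (update p m c)
  have "Poly_Mapping.update m c p = Poly_Mapping.single m c + p"
    using update.hyps(1)
    by (intro poly_mapping_eqI) (auto simp: lookup_update lookup_add lookup_single when_def in_keys_iff)
  then show ?case
    using assms(2)[OF update.IH] by simp
qed (rule assms(1))

lemma mpoly_val_mult: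
  assumes "h 0 = 0" "\<And>x y. h (x + y) = h x + h y" "\<And>x y. h (x * y) = h x * h y"
  shows "mpoly_val h e (p * q) = mpoly_val h e p * mpoly_val h e q"
proof (induction p rule: poly_mapping_single_add_induct)
  case zero
  then show ?case
    by (simp add: mpoly_val_def)
next
  case (single_add m c p)
  have "mpoly_val h e (Poly_Mapping.single m c * q) =
      mpoly_val h e (Poly_Mapping.single m c) * mpoly_val h e q"
  proof (induction q rule: poly_mapping_single_add_induct)
    case zero
    then show ?case
      by (simp add: mpoly_val_def)
  next
    case (single_add m' c' q)
    then show ?case
      by (simp add: distrib_left mpoly_val_add[OF assms(1,2)] mult_single
        mpoly_val_single[where h = h, OF assms(1)] monomial_val_add assms(3) algebra_simps)
  qed
  then show ?case
    using single_add.IH by (simp add: distrib_right mpoly_val_add[OF assms(1,2)])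
qed

lemma tm_val_eq_mpoly_val: "tm_val e t = mpoly_val of_int e (tm_poly t)"
proof (induction t)
  case One
  show ?case
    by (simp add: mpoly_val_def monomial_val_def flip: single_one)
next
  case (Sub s t)
  have "mpoly_val of_int e (tm_poly s) = mpoly_val of_int e (tm_poly s - tm_poly t) + mpoly_val of_int e (tm_poly t)"
    by (simp flip: mpoly_val_add)
  then show ?case
    using Sub by simp
qed (simp_all add: mpoly_val_add mpoly_val_mult mpoly_val_single, simp_all add: mpoly_val_def monomial_val_def)

lemma diff_poly_val_eq_mpoly_val:
  "diff_poly_val \<delta> a p = mpoly_val (\<lambda>c. c) (\<lambda>(i, j). (\<delta> ^^ j) (a ! i)) p"
  unfolding diff_poly_val_def mpoly_val_def monomial_val_def
  by (intro sum.cong arg_cong2[of _ _ _ _ "(*)"] prod.cong) auto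

text \<open>The functions computed by differential polynomials, presented by generators so that closure
  properties are proved without handling coefficients.\<close>

inductive_set diff_poly_functions :: "('a::comm_ring_1 \<Rightarrow> 'a) \<Rightarrow> nat \<Rightarrow> ('a list \<Rightarrow> 'a) set"
  for \<delta> n where
  const: "(\<lambda>_. c) \<in> diff_poly_functions \<delta> n"
| var: "i < n \<Longrightarrow> (\<lambda>a. (\<delta> ^^ j) (a ! i)) \<in> diff_poly_functions \<delta> n"
| add: "f \<in> diff_poly_functions \<delta> n \<Longrightarrow> g \<in> diff_poly_functions \<delta> n \<Longrightarrow>
    (\<lambda>a. f a + g a) \<in> diff_poly_functions \<delta> n"
| mult: "f \<in> diff_poly_functions \<delta> n \<Longrightarrow> g \<in> diff_poly_functions \<delta> n \<Longrightarrow>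
    (\<lambda>a. f a * g a) \<in> diff_poly_functions \<delta> n"

lemma diff_poly_functions_diff:
  assumes "f \<in> diff_poly_functions \<delta> n" "g \<in> diff_poly_functions \<delta> n"
  shows "(\<lambda>a. f a - g a) \<in> diff_poly_functions \<delta> n"
proof -
  have "(\<lambda>a. f a + (- 1) * g a) \<in> diff_poly_functions \<delta> n"
    by (intro diff_poly_functions.intros assms)
  then show ?thesis
    by simp
qed

lemma diff_poly_functions_sum:
  assumes "\<And>x. x \<in> A \<Longrightarrow> f x \<in> diff_poly_functions \<delta> n"
  shows "(\<lambda>a. \<Sum>x\<in>A. f x a) \<in> diff_poly_functions \<delta> n"
  using assms
  by (induction A rule: infinite_finite_induct) (auto intro: diff_poly_functions.intros)

lemma diff_poly_functions_prod:
  assumes "\<And>x. x \<in> A \<Longrightarrow> f x \<in> diff_poly_functions \<delta> n"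
  shows "(\<lambda>a. \<Prod>x\<in>A. f x a) \<in> diff_poly_functions \<delta> n"
  using assms
  by (induction A rule: infinite_finite_induct) (auto intro: diff_poly_functions.intros)

lemma diff_poly_functions_power:
  assumes "f \<in> diff_poly_functions \<delta> n"
  shows "(\<lambda>a. f a ^ k) \<in> diff_poly_functions \<delta> n"
  using assms by (induction k) (auto intro: diff_poly_functions.intros)

lemma diff_poly_functions_derivation:
  assumes "derivation \<delta>" "f \<in> diff_poly_functions \<delta> n"
  shows "(\<lambda>a. \<delta> (f a)) \<in> diff_poly_functions \<delta> n"
  using assms(2)
proof induction
  case (const c)
  show ?case
    by (rule diff_poly_functions.const)
next
  case (var i j)
  then show ?case
    using diff_poly_functions.var[OF var, where j = "Suc j"] by simp
next
  case (add f g)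
  then show ?case
    unfolding derivation_add[OF assms(1)] by (intro diff_poly_functions.add)
next
  case (mult f g)
  then show ?case
    unfolding derivation_mult[OF assms(1)]
    by (intro diff_poly_functions.add diff_poly_functions.mult)
qed

lemma diff_poly_functions_derivation_pow:
  assumes "derivation \<delta>" "f \<in> diff_poly_functions \<delta> n"
  shows "(\<lambda>a. (\<delta> ^^ k) (f a)) \<in> diff_poly_functions \<delta> n"
proof (induction k)
  case (Suc k)
  then show ?case
    using diff_poly_functions_derivation[OF assms(1) Suc] by simp
qed (simp add: assms(2))

lemma diff_poly_functions_representable:
  assumes "f \<in> diff_poly_functions \<delta> n"
  shows "\<exists>p. diff_poly_in n p \<and> (\<forall>a. diff_poly_val \<delta> a p = f a)"
  using assms
proof induction
  case (const c)
  show ?case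
    by (rule exI[of _ "Poly_Mapping.single 0 c"])
      (auto simp: diff_poly_in_def diff_poly_val_eq_mpoly_val mpoly_val_single monomial_val_def
        split: if_splits)
next
  case (var i j)
  then show ?case
    by (intro exI[of _ "Poly_Mapping.single (Poly_Mapping.single (i, j) 1) 1"])
      (auto simp: diff_poly_in_def diff_poly_val_eq_mpoly_val mpoly_val_single monomial_val_def)
next
  case (add f g)
  then obtain p q where p: "diff_poly_in n p" "\<And>a. diff_poly_val \<delta> a p = f a"
    and q: "diff_poly_in n q" "\<And>a. diff_poly_val \<delta> a q = g a"
    by blast
  have "diff_poly_in n (p + q)"
    using p(1) q(1) Poly_Mapping.keys_add[of p q] unfolding diff_poly_in_def by blast
  moreover have "diff_poly_val \<delta> a (p + q) = f a + g a" for a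
    using p(2)[of a] q(2)[of a] unfolding diff_poly_val_eq_mpoly_val by (simp add: mpoly_val_add)
  ultimately show ?case
    by blast
next
  case (mult f g)
  then obtain p q where p: "diff_poly_in n p" "\<And>a. diff_poly_val \<delta> a p = f a"
    and q: "diff_poly_in n q" "\<And>a. diff_poly_val \<delta> a q = g a"
    by blast
  have "diff_poly_in n (p * q)"
    unfolding diff_poly_in_def
  proof (intro ballI)
    fix m v
    assume "m \<in> Poly_Mapping.keys (p * q)" and v: "v \<in> Poly_Mapping.keys m"
    then obtain m1 m2 where "m = m1 + m2" "m1 \<in> Poly_Mapping.keys p" "m2 \<in> Poly_Mapping.keys q"
      using keys_mult[of p q] by blast
    then show "case v of (i, j) \<Rightarrow> i < n"
      using v p(1) q(1) Poly_Mapping.keys_add[of m1 m2] unfolding diff_poly_in_def by blast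
  qed
  moreover have "diff_poly_val \<delta> a (p * q) = f a * g a" for a
    using p(2)[of a] q(2)[of a] unfolding diff_poly_val_eq_mpoly_val by (simp add: mpoly_val_mult)
  ultimately show ?case
    by blast
qed

lemma Kolchin_closed_zero_locus:
  assumes "zero_locus (diff_poly_functions \<delta> n) S"
  shows "Kolchin_closed \<delta> n {a. length a = n \<and> a \<in> S}"
proof -
  obtain F where F: "F \<subseteq> diff_poly_functions \<delta> n" "S = {a. \<forall>f\<in>F. f a = 0}"
    using assms unfolding zero_locus_def by (elim exE conjE) (rule that)
  have "\<forall>f\<in>F. \<exists>p. diff_poly_in n p \<and> (\<forall>a. diff_poly_val \<delta> a p = f a)"
    using F(1) diff_poly_functions_representable by blast
  from bchoice[OF this] obtain P
    where P: "\<forall>f\<in>F. diff_poly_in n (P f) \<and> (\<forall>a. diff_poly_val \<delta> a (P f) = f a)" ..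
  show ?thesis
    unfolding Kolchin_closed_def
  proof (intro exI[of _ "P ` F"] conjI)
    show "\<forall>p\<in>P ` F. diff_poly_in n p"
      using P by simp
    show "{a. length a = n \<and> a \<in> S} = {a. length a = n \<and> (\<forall>p\<in>P ` F. diff_poly_val \<delta> a p = 0)}"
      unfolding F(2) using P by simp
  qed
qed

section \<open>Tame formulas\<close>

lemma sat_conjs: "sat I e (conjs \<phi>s) \<longleftrightarrow> (\<forall>\<phi>\<in>set \<phi>s. sat I e \<phi>)"
  by (induction \<phi>s) (simp_all add: conjs_def)

text \<open>The quantified variables may be assigned simultaneously; a repeated variable takes the value of
  its innermost quantifier.\<close>

lemma sat_exs: "sat I e (exs vs \<phi>) \<longleftrightarrow> (\<exists>c. sat I (\<lambda>v. if v \<in> set vs then c v else e v) \<phi>)"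
proof (induction vs arbitrary: e)
  case Nil
  then show ?case
    by (simp add: exs_def)
next
  case (Cons v vs)
  have "sat I e (exs (v # vs) \<phi>) \<longleftrightarrow>
      (\<exists>x c. sat I (\<lambda>w. if w \<in> set vs then c w else (e(v := x)) w) \<phi>)"
    using Cons.IH by (simp add: exs_def)
  also have "\<dots> \<longleftrightarrow> (\<exists>c. sat I (\<lambda>w. if w \<in> set (v # vs) then c w else e w) \<phi>)"
  proof
    assume "\<exists>x c. sat I (\<lambda>w. if w \<in> set vs then c w else (e(v := x)) w) \<phi>"
    then obtain x c where "sat I (\<lambda>w. if w \<in> set vs then c w else (e(v := x)) w) \<phi>"
      by blast
    also have "(\<lambda>w. if w \<in> set vs then c w else (e(v := x)) w) =
        (\<lambda>w. if w \<in> set (v # vs) then (if w \<in> set vs then c w else x) else e w)"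
      by auto
    finally show "\<exists>c. sat I (\<lambda>w. if w \<in> set (v # vs) then c w else e w) \<phi>"
      by (rule exI[of _ "\<lambda>w. if w \<in> set vs then c w else x"])
  next
    assume "\<exists>c. sat I (\<lambda>w. if w \<in> set (v # vs) then c w else e w) \<phi>"
    then obtain c where "sat I (\<lambda>w. if w \<in> set (v # vs) then c w else e w) \<phi>"
      by blast
    also have "(\<lambda>w. if w \<in> set (v # vs) then c w else e w) =
        (\<lambda>w. if w \<in> set vs then c w else (e(v := c v)) w)"
      by auto
    finally show "\<exists>x c. sat I (\<lambda>w. if w \<in> set vs then c w else (e(v := x)) w) \<phi>"
      by blast
  qed
  finally show ?case .
qed

lemma pair_models_tame_fm:
  "pair_models E (tame_fm k r ts) a \<longleftrightarrow>
     (\<exists>\<zeta>. (\<forall>z\<in>{k..<k + r}. \<zeta> z \<in> E) \<and> (\<exists>z\<in>{k..<k + r}. \<zeta> z \<noteq> 0) \<and>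
        (\<forall>t\<in>set ts. tm_val (\<lambda>v. if v \<in> {k..<k + r} then \<zeta> v else nth_default 0 a v) t = 0))"
  unfolding pair_models_def tame_fm_def Let_def sat_exs
  by (simp add: sat_conjs)

definition restrict_monomial :: "'v set \<Rightarrow> ('v \<Rightarrow>\<^sub>0 nat) \<Rightarrow> 'v multiset" where
  "restrict_monomial Z m =
     (\<Sum>v\<in>Poly_Mapping.keys m \<inter> Z. replicate_mset (Poly_Mapping.lookup m v) v)"

lemma restrict_monomial_in_multisets_of_size:
  "restrict_monomial Z m \<in>
     multisets_of_size Z (\<Sum>v\<in>Poly_Mapping.keys m \<inter> Z. Poly_Mapping.lookup m v)"
proof -
  have "(\<Sum>v\<in>A. replicate_mset (c v) v) \<in> multisets_of_size A (sum c A)"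
    if "finite A" for A :: "'a set" and c
    using that by (induction A rule: finite_induct) (auto simp: multisets_of_size_def split: if_splits)
  from this[of "Poly_Mapping.keys m \<inter> Z"] show ?thesis
    unfolding restrict_monomial_def multisets_of_size_def by auto
qed

lemma prod_restrict_monomial:
  "(\<Prod>i\<in>#restrict_monomial Z m. \<zeta> i) = (\<Prod>v\<in>Poly_Mapping.keys m \<inter> Z. \<zeta> v ^ Poly_Mapping.lookup m v)"
proof -
  have "(\<Prod>i\<in>#(\<Sum>v\<in>A. replicate_mset (c v) v). \<zeta> i) = (\<Prod>v\<in>A. \<zeta> v ^ c v)" if "finite A" for A c
    using that by (induction A rule: finite_induct) simp_all
  then show ?thesis
    unfolding restrict_monomial_def by simp
qed

text \<open>The coefficient of the monomial \<open>\<mu>\<close> when \<open>q\<close> is read as a polynomial in the variables \<open>Z\<close>, the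
  remaining variables being evaluated at \<open>e\<close>.\<close>

definition form_coeff ::
    "('b::zero \<Rightarrow> 'a::comm_semiring_1) \<Rightarrow> 'v set \<Rightarrow> (('v \<Rightarrow>\<^sub>0 nat) \<Rightarrow>\<^sub>0 'b) \<Rightarrow> ('v \<Rightarrow> 'a) \<Rightarrow> 'v multiset \<Rightarrow> 'a" where
  "form_coeff h Z q e \<mu> =
     (\<Sum>m | m \<in> Poly_Mapping.keys q \<and> restrict_monomial Z m = \<mu>.
        h (Poly_Mapping.lookup q m) * (\<Prod>v\<in>Poly_Mapping.keys m - Z. e v ^ Poly_Mapping.lookup m v))"

lemma mpoly_val_homogeneous:
  assumes "finite Z"
    and "\<And>m. m \<in> Poly_Mapping.keys q \<Longrightarrow> (\<Sum>v\<in>Poly_Mapping.keys m \<inter> Z. Poly_Mapping.lookup m v) = d"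
  shows "mpoly_val h (\<lambda>v. if v \<in> Z then \<zeta> v else e v) q =
           (\<Sum>\<mu>\<in>multisets_of_size Z d. form_coeff h Z q e \<mu> * (\<Prod>i\<in>#\<mu>. \<zeta> i))"
proof -
  let ?e = "\<lambda>v. if v \<in> Z then \<zeta> v else e v"
  let ?c = "\<lambda>m. h (Poly_Mapping.lookup q m) * (\<Prod>v\<in>Poly_Mapping.keys m - Z. e v ^ Poly_Mapping.lookup m v)"
  have split: "monomial_val ?e m = (\<Prod>v\<in>Poly_Mapping.keys m - Z. e v ^ Poly_Mapping.lookup m v) *
      (\<Prod>i\<in>#restrict_monomial Z m. \<zeta> i)" for m
  proof -
    have "Poly_Mapping.keys m = (Poly_Mapping.keys m - Z) \<union> (Poly_Mapping.keys m \<inter> Z)"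
      by blast
    then have "monomial_val ?e m = (\<Prod>v\<in>(Poly_Mapping.keys m - Z) \<union> (Poly_Mapping.keys m \<inter> Z).
        ?e v ^ Poly_Mapping.lookup m v)"
      unfolding monomial_val_def by simp
    also have "\<dots> = (\<Prod>v\<in>Poly_Mapping.keys m - Z. ?e v ^ Poly_Mapping.lookup m v) *
        (\<Prod>v\<in>Poly_Mapping.keys m \<inter> Z. ?e v ^ Poly_Mapping.lookup m v)"
      by (rule prod.union_disjoint) auto
    finally show ?thesis
      unfolding prod_restrict_monomial by simp
  qed
  have "mpoly_val h ?e q = (\<Sum>m\<in>Poly_Mapping.keys q. ?c m * (\<Prod>i\<in>#restrict_monomial Z m. \<zeta> i))"
    unfolding mpoly_val_def split by (simp add: mult.assoc)
  also have "\<dots> = (\<Sum>\<mu>\<in>multisets_of_size Z d. \<Sum>m\<in>{m \<in> Poly_Mapping.keys q. restrict_monomial Z m = \<mu>}.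
      ?c m * (\<Prod>i\<in>#restrict_monomial Z m. \<zeta> i))"
  proof (rule sum.group[symmetric])
    show "restrict_monomial Z ` Poly_Mapping.keys q \<subseteq> multisets_of_size Z d"
      using restrict_monomial_in_multisets_of_size[of Z] assms(2) by fastforce
  qed (use assms(1) in auto)
  also have "\<dots> = (\<Sum>\<mu>\<in>multisets_of_size Z d. form_coeff h Z q e \<mu> * (\<Prod>i\<in>#\<mu>. \<zeta> i))"
    unfolding form_coeff_def sum_distrib_right by (intro sum.cong) auto
  finally show ?thesis .
qed

theorem proposition9p9:
  fixes \<delta> :: "'a::alg_closed_field \<Rightarrow> 'a"
    and \<kappa> :: "'c rel"
    and \<phi> :: "p_atom fm"
    and n m :: nat
    and b :: "'a list"
  assumes "derivation \<delta>"
    and "\<exists>x. \<delta> x \<noteq> 0"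
    and "Cinfinite \<kappa>"
    and "saturated \<kappa> (diff_structure \<delta>)"
    and "tame (n + m) \<phi>"
    and "length b = m"
  shows "Kolchin_closed \<delta> n {a. length a = n \<and> pair_models (constants \<delta>) \<phi> (a @ b)}"
proof -
  interpret root_closed_subfield "constants \<delta>"
    by (rule constants_root_closed_subfield[OF assms(1,2)])
  obtain r ts where \<phi>: "\<phi> = tame_fm (n + m) r ts"
    and hom: "\<forall>t\<in>set ts. homogeneous_in {n + m..<n + m + r} (tm_poly t)"
    using assms(5) unfolding tame_def by blast
  define Z where "Z = {n + m..<n + m + r}"
  have "finite Z"
    by (simp add: Z_def)
  obtain d where d: "\<forall>t\<in>set ts. \<forall>\<mu>\<in>Poly_Mapping.keys (tm_poly t).
      (\<Sum>v\<in>Poly_Mapping.keys \<mu> \<inter> Z. Poly_Mapping.lookup \<mu> v) = d t"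
    using bchoice[OF hom[unfolded homogeneous_in_def, folded Z_def]] ..
  \<comment> \<open>The values of the free variables. For tuples of length \<open>n\<close> this is the assignment given by
    \<open>a @ b\<close>, but written so that each value is a differential polynomial function on all lists.\<close>
  define x where "x a v = (if v < n then a ! v else nth_default 0 b (v - n))" for a and v :: nat
  define g where "g a t = form_coeff of_int Z (tm_poly t) (x a)" for a t
  define M where "M N = multisets_of_size Z N" for N
  define R where "R = diff_poly_functions \<delta> n"
  define V where "V N = {(t, \<nu>). t \<in> set ts \<and> set_mset \<nu> \<subseteq> Z \<and> size \<nu> + d t = N}" for N
  \<comment> \<open>The condition in degree \<open>N\<close> after constants have been traded for derivatives.\<close>
  define D where "D N = {a. \<exists>f. (\<exists>\<beta>\<in>M N. f \<beta> \<noteq> 0) \<and>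
      (\<forall>w\<in>(\<lambda>((t, \<nu>), k) \<beta> a. (\<delta> ^^ k) (multiple_coeff (g a t) \<nu> \<beta>)) ` (V N \<times> UNIV).
         (\<Sum>\<beta>\<in>M N. f \<beta> * w \<beta> a) = 0)}" for N
  have coefficient: "(\<lambda>a. multiple_coeff (g a t) \<nu> \<beta>) \<in> R" for t \<nu> \<beta>
  proof -
    have "(\<lambda>a. x a v) \<in> R" for v
    proof (cases "v < n")
      case True
      then show ?thesis
        unfolding x_def R_def using diff_poly_functions.var[OF True, where j = 0] by simp
    qed (simp add: x_def R_def diff_poly_functions.const)
    then have "(\<lambda>a. g a t \<mu>) \<in> R" for \<mu>
      unfolding g_def form_coeff_def R_def
      by (intro diff_poly_functions_sum diff_poly_functions.mult diff_poly_functions.const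
        diff_poly_functions_prod diff_poly_functions_power)
    then show ?thesis
      by (cases "\<nu> \<subseteq># \<beta>") (simp_all add: multiple_coeff_def R_def diff_poly_functions.const)
  qed
  have "zero_locus R (D N)" for N
    unfolding D_def
  proof (rule zero_locus_linear_dependence)
    show "finite (M N)"
      unfolding M_def using \<open>finite Z\<close> by (rule finite_multisets_of_size)
    show "w \<beta> \<in> R"
      if "w \<in> (\<lambda>((t, \<nu>), k) \<beta> a. (\<delta> ^^ k) (multiple_coeff (g a t) \<nu> \<beta>)) ` (V N \<times> UNIV)" for w \<beta>
      using that diff_poly_functions_derivation_pow[OF assms(1) coefficient[unfolded R_def]]
      unfolding R_def by auto
  qed (simp_all add: R_def diff_poly_functions.const diff_poly_functions_diff diff_poly_functions.mult)
  then have "zero_locus R (\<Inter>N. D N)"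
    by (intro zero_locus_INT)
  moreover have "pair_models (constants \<delta>) \<phi> (a @ b) \<longleftrightarrow> a \<in> (\<Inter>N. D N)" if "length a = n" for a
  proof -
    have x: "nth_default 0 (a @ b) = x a"
      using that by (auto simp: x_def nth_default_append)
    have val: "tm_val (\<lambda>v. if v \<in> Z then \<zeta> v else x a v) t =
        (\<Sum>\<mu>\<in>M (d t). g a t \<mu> * (\<Prod>i\<in>#\<mu>. \<zeta> i))" if "t \<in> set ts" for t \<zeta>
      unfolding tm_val_eq_mpoly_val M_def g_def
      by (rule mpoly_val_homogeneous[OF \<open>finite Z\<close>]) (use d that in blast)
    have "pair_models (constants \<delta>) \<phi> (a @ b) \<longleftrightarrow>
        (\<exists>\<zeta>. (\<forall>i\<in>Z. \<zeta> i \<in> constants \<delta>) \<and> (\<exists>i\<in>Z. \<zeta> i \<noteq> 0) \<and>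
           (\<forall>t\<in>set ts. (\<Sum>\<mu>\<in>M (d t). g a t \<mu> * (\<Prod>i\<in>#\<mu>. \<zeta> i)) = 0))"
      unfolding \<phi> pair_models_tame_fm x Z_def[symmetric] by (simp add: val cong: conj_cong)
    also have "\<dots> \<longleftrightarrow> (\<forall>N. \<exists>f. (\<forall>\<beta>. f \<beta> \<in> constants \<delta>) \<and> (\<exists>\<beta>\<in>M N. f \<beta> \<noteq> 0) \<and>
        (\<forall>t\<in>set ts. \<forall>\<nu>. set_mset \<nu> \<subseteq> Z \<longrightarrow> size \<nu> + d t = N \<longrightarrow>
           (\<Sum>\<beta>\<in>M N. f \<beta> * multiple_coeff (g a t) \<nu> \<beta>) = 0))"
      unfolding M_def by (rule homogeneous_Nullstellensatz[OF \<open>finite Z\<close>])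
    also have "\<dots> \<longleftrightarrow> (\<forall>N. \<exists>f. (\<forall>\<beta>. f \<beta> \<in> constants \<delta>) \<and> (\<exists>\<beta>\<in>M N. f \<beta> \<noteq> 0) \<and>
        (\<forall>w\<in>(\<lambda>(t, \<nu>). multiple_coeff (g a t) \<nu>) ` V N. (\<Sum>\<beta>\<in>M N. f \<beta> * w \<beta>) = 0))"
    proof -
      have "(\<forall>t\<in>set ts. \<forall>\<nu>. set_mset \<nu> \<subseteq> Z \<longrightarrow> size \<nu> + d t = N \<longrightarrow> P t \<nu>) \<longleftrightarrow>
          (\<forall>(t, \<nu>)\<in>V N. P t \<nu>)" for P N
        by (auto simp: V_def)
      then show ?thesis
        by (simp add: split_beta)
    qed
    also have "\<dots> \<longleftrightarrow> (\<forall>N. \<exists>f. (\<exists>\<beta>\<in>M N. f \<beta> \<noteq> 0) \<and>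
        (\<forall>w\<in>(\<lambda>(t, \<nu>). multiple_coeff (g a t) \<nu>) ` V N. \<forall>k. (\<Sum>\<beta>\<in>M N. f \<beta> * (\<delta> ^^ k) (w \<beta>)) = 0))"
      unfolding M_def
      by (intro iff_allI constant_annihilator_iff[OF assms(1)] finite_multisets_of_size \<open>finite Z\<close>)
    also have "\<dots> \<longleftrightarrow> a \<in> (\<Inter>N. D N)"
      by (simp add: D_def split_beta)
    finally show ?thesis .
  qed
  then have "{a. length a = n \<and> pair_models (constants \<delta>) \<phi> (a @ b)} =
      {a. length a = n \<and> a \<in> (\<Inter>N. D N)}"
    by blast
  ultimately show ?thesis
    unfolding R_def by (simp only: Kolchin_closed_zero_locus)
qed

end
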